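(* Let $d\ge2$, let $p_1,\dots,p_{d-1}\in(0,1)$, and let $S\subsetneq[d]$ be any proper subset of the coordinates which includes $1$. Then the marginal of the Brownian separable $d$-permuton $\mu^B_{p_1,\dots,p_{d-1}}$ on the coordinate set $S$ does not determine the full permuton: there is no deterministic measurable function $F$ such that, almost surely, $\mu^B_{p_1,\dots,p_{d-1}}$ equals $F$ applied to the marginal of $\mu^B_{p_1,\dots,p_{d-1}}$ on the coordinates in $S$.
   Context: A $d$-permuton is a Borel probability measure on $[0,1]^d$ with uniform one-dimensional marginals; spaces of (marginals of) permutons carry the weak topology and its Borel $\sigma$-algebra. For $S\subseteq[d]=\{1,\dots,d\}$, the marginal of a measure on the coordinate set $S$ is its pushforward under the projection onto the coordinates in $S$. Brownian separable $d$-permuton $\mu^B_{p_1,\dots,p_{d-1}}$. Let $e$ be a one-dimensional (normalized) Brownian excursion on $[0,1]$. Given $e$, label its countably many local minima $\ell$ by iid sign vectors $s(\ell)=(s_1(\ell),\dots,s_{d-1}(\ell))$ with independent entries, $s_i(\ell)=+1$ with probability $p_i$ and $-1$ with probability $1-p_i$. There is a random null set $N$ such that for $x<y$ in $[0,1]\setminus N$, $e$ attains its minimum on $[x,y]$ at a unique point $\ell$; set $x<_e^{(i)}y$ if $s_i(\ell)=+1$ and $y<_e^{(i)}x$ otherwise. Let $\psi_e^{(i)}(t)=\mathrm{Leb}(\{x\in[0,1]:x<_e^{(i)}t\})$ and $\mu^B_{p_1,\dots,p_{d-1}}(A)=\mathrm{Leb}(\{t\in[0,1]:(t,\psi_e^{(1)}(t),\dots,\psi_e^{(d-1)}(t))\in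 A\})$. *)

theory Defs
  imports "HOL-Probability.Probability"
begin

section \<open>The normalized Brownian excursion\<close>

text \<open>Density at \<open>x\<close> of the entrance law at time \<open>t\<close> of Ito's measure, up to normalization; it is also
  the density in \<open>t\<close> of the hitting time of 0 for Brownian motion started at \<open>x\<close>.\<close>

definition entrance_density :: "real \<Rightarrow> real \<Rightarrow> real" where
  "entrance_density t x = x / t * normal_density 0 (sqrt t) x"

text \<open>Transition density of Brownian motion killed at 0 (reflection principle), for \<open>x, y > 0\<close>.\<close>

definition killed_kernel :: "real \<Rightarrow> real \<Rightarrow> real \<Rightarrow> real" where
  "killed_kernel t x y = normal_density x (sqrt t) y - normal_density (- x) (sqrt t) y"

text \<open>Joint density of the excursion at the \<open>m + 1\<close> times \<open>t 0 < \<dots> < t m\<close> in \<open>(0,1)\<close>.\<close>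

definition excursion_density :: "nat \<Rightarrow> (nat \<Rightarrow> real) \<Rightarrow> (nat \<Rightarrow> real) \<Rightarrow> real" where
  "excursion_density m t x =
    (if \<forall>k\<le>m. 0 < x k
     then 2 * sqrt (2 * pi) * entrance_density (t 0) (x 0)
          * (\<Prod>k<m. killed_kernel (t (Suc k) - t k) (x k) (x (Suc k)))
          * entrance_density (1 - t m) (x m)
     else 0)"

text \<open>The law of the normalized excursion on the space of continuous paths is given by its
  finite-dimensional distributions. Only the restriction of \<open>e \<omega>\<close> to \<open>[0,1]\<close> matters.\<close>

locale brownian_excursion = prob_space M for M :: "'a measure" +
  fixes e :: "'a \<Rightarrow> real \<Rightarrow> real"
  assumes random_variable_excursion:
      "\<And>t. t \<in> {0..1} \<Longrightarrow> random_variable borel (\<lambda>\<omega>. e \<omega> t)"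
    and continuous_excursion: "AE \<omega> in M. continuous_on {0..1} (e \<omega>)"
    and excursion_endpoints: "AE \<omega> in M. e \<omega> 0 = 0 \<and> e \<omega> 1 = 0"
    and distributed_excursion:
      "\<And>m t. 0 < t 0 \<Longrightarrow> (\<And>k. k < m \<Longrightarrow> t k < t (Suc k)) \<Longrightarrow> t m < 1 \<Longrightarrow>
        distributed M (\<Pi>\<^sub>M k\<in>{..m}. lborel) (\<lambda>\<omega>. \<lambda>k\<in>{..m}. e \<omega> (t k))
          (\<lambda>x. ennreal (excursion_density m t x))"


section \<open>Signs on the local minima\<close>

definition local_minima :: "(real \<Rightarrow> real) \<Rightarrow> real set" where
  "local_minima f = {l \<in> {0<..<1}. \<forall>\<^sub>F u in at l. f l \<le> f u}"

definition unique_minimum_at :: "(real \<Rightarrow> real) \<Rightarrow> real \<Rightarrow> real \<Rightarrow> real \<Rightarrow> bool" where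
  "unique_minimum_at f x y l \<longleftrightarrow> l \<in> {x..y} \<and> (\<forall>u\<in>{x..y} - {l}. f l < f u)"

definition sign_pmf :: "real \<Rightarrow> int pmf" where
  "sign_pmf q = map_pmf (\<lambda>b. if b then 1 else - 1) (bernoulli_pmf q)"

text \<open>\<open>s \<omega> i l\<close> is the \<open>i\<close>-th sign of the local minimum \<open>l\<close>; its values at other points are
  irrelevant. To speak of iid labels of a random countable set one needs some measurable enumeration
  \<open>ell\<close> of that set which carries no information on the labels: hence the signs are independent of
  the pair \<open>(e, ell)\<close>. This holds automatically when \<open>ell\<close> is a function of \<open>e\<close>, and the
  joint law of \<open>e\<close> and its labelled minima does not depend on the choice of \<open>ell\<close>.

  The enumeration and the last assumption record two well-known almost sure properties of the
  excursion, both consequences of its law: the local minima form a countable infinite set, and off a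
  null set the minimum over an interval is attained once, at a (labelled) local minimum. They exclude
  no excursion and make the orders below well defined.\<close>

locale labelled_brownian_excursion = brownian_excursion M e
  for M :: "'a measure" and e :: "'a \<Rightarrow> real \<Rightarrow> real" +
  fixes d :: nat and p :: "nat \<Rightarrow> real"
    and ell :: "nat \<Rightarrow> 'a \<Rightarrow> real"
    and s :: "'a \<Rightarrow> nat \<Rightarrow> real \<Rightarrow> int"
  assumes random_variable_ell: "\<And>n. random_variable borel (ell n)"
    and random_variable_sign:
      "\<And>i n. i \<in> {1..<d} \<Longrightarrow> random_variable (count_space UNIV) (\<lambda>\<omega>. s \<omega> i (ell n \<omega>))"
    and enumeration: "AE \<omega> in M. bij_betw (\<lambda>n. ell n \<omega>) UNIV (local_minima (e \<omega>))"
    and iid_signs: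
      "let P = (\<Pi>\<^sub>M t\<in>{0..1}. borel) \<Otimes>\<^sub>M (\<Pi>\<^sub>M n\<in>UNIV. borel);
           Q = (\<Pi>\<^sub>M (i, n)\<in>{1..<d} \<times> UNIV. measure_pmf (sign_pmf (p i)));
           X = (\<lambda>\<omega>. (\<lambda>t\<in>{0..1}. e \<omega> t, \<lambda>n. ell n \<omega>));
           Y = (\<lambda>\<omega>. \<lambda>(i, n)\<in>{1..<d} \<times> UNIV. s \<omega> i (ell n \<omega>))
       in distr M (P \<Otimes>\<^sub>M Q) (\<lambda>\<omega>. (X \<omega>, Y \<omega>)) = distr M P X \<Otimes>\<^sub>M Q"
    and unique_minima:
      "AE \<omega> in M. \<exists>N \<in> null_sets lborel. \<forall>x \<in> {0..1} - N. \<forall>y \<in> {0..1} - N. x < y \<longrightarrow>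
        (\<exists>l \<in> local_minima (e \<omega>). unique_minimum_at (e \<omega>) x y l)"


section \<open>Permutons\<close>

text \<open>For finite \<open>S\<close> the product \<sigma>-algebra is the Borel \<sigma>-algebra of \<open>[0,1]\<^sup>S\<close>.\<close>

definition cube :: "nat set \<Rightarrow> (nat \<Rightarrow> real) measure" where
  "cube S = (\<Pi>\<^sub>M i\<in>S. restrict_space borel {0..1})"

definition cube_topology :: "nat set \<Rightarrow> (nat \<Rightarrow> real) topology" where
  "cube_topology S = product_topology (\<lambda>_. top_of_set {0..1}) S"

definition permutons :: "nat set \<Rightarrow> (nat \<Rightarrow> real) measure set" where
  "permutons S = {\<mu>. prob_space \<mu> \<and> sets \<mu> = sets (cube S) \<and>
    (\<forall>i\<in>S. distr \<mu> (restrict_space borel {0..1}) (\<lambda>x. x i) = restrict_space lborel {0..1})}"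

text \<open>Weak topology: the coarsest one making \<open>\<mu> \<mapsto> \<integral>f d\<mu>\<close> continuous for all continuous \<open>f\<close> on the
  compact space \<open>[0,1]\<^sup>S\<close> (such \<open>f\<close> are bounded).\<close>

definition weak_topology :: "nat set \<Rightarrow> (nat \<Rightarrow> real) measure topology" where
  "weak_topology S = topology_generated_by
    {{\<mu> \<in> permutons S. (\<integral>x. f x \<partial>\<mu>) \<in> U} | f U.
      continuous_map (cube_topology S) euclideanreal f \<and> open U}"

definition borel_of :: "'b topology \<Rightarrow> 'b measure" where
  "borel_of T = sigma (topspace T) {U. openin T U}"

definition marginal :: "nat set \<Rightarrow> (nat \<Rightarrow> real) measure \<Rightarrow> (nat \<Rightarrow> real) measure" where
  "marginal S \<mu> = distr \<mu> (cube S) (\<lambda>x. restrict x S)"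


section \<open>The Brownian separable permuton\<close>

text \<open>The order induced by a path \<open>f\<close> and signs \<open>g\<close>. For the excursion, the minimum is a local minimum in
  \<open>(x,y)\<close> for all \<open>x, y\<close> off a null set. Asking for an interior minimum only fixes the
  convention for exceptional pairs, so that \<open>g\<close> is evaluated at local minima alone and all
  sets below are measurable as soon as these are countable.\<close>

definition positive_at_minimum :: "(real \<Rightarrow> real) \<Rightarrow> (real \<Rightarrow> int) \<Rightarrow> real \<Rightarrow> real \<Rightarrow> bool" where
  "positive_at_minimum f g x y \<longleftrightarrow> (\<exists>l\<in>{x<..<y}. unique_minimum_at f x y l \<and> g l = 1)"

definition excursion_less :: "(real \<Rightarrow> real) \<Rightarrow> (real \<Rightarrow> int) \<Rightarrow> real \<Rightarrow> real \<Rightarrow> bool" where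
  "excursion_less f g x y \<longleftrightarrow>
    (x < y \<and> positive_at_minimum f g x y) \<or> (y < x \<and> \<not> positive_at_minimum f g y x)"

definition psi :: "(real \<Rightarrow> real) \<Rightarrow> (real \<Rightarrow> int) \<Rightarrow> real \<Rightarrow> real" where
  "psi f g t = measure lebesgue {x \<in> {0..1}. excursion_less f g x t}"

definition separable_permuton ::
  "nat \<Rightarrow> (real \<Rightarrow> real) \<Rightarrow> (nat \<Rightarrow> real \<Rightarrow> int) \<Rightarrow> (nat \<Rightarrow> real) measure" where
  "separable_permuton d f g = distr (lebesgue_on {0..1}) (cube {1..d})
    (\<lambda>t. \<lambda>k\<in>{1..d}. if k = 1 then t else psi f (g (k - 1)) t)"

end

theory Submission
  imports Defs
begin

text \<open>
  A coordinate that is left out carries signs of its own, and the other coordinates tell nothing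
  about them. To turn this into a proof, fix a coordinate \<open>\<kappa>\<close> outside \<open>S\<close>, put \<open>j = \<kappa> - 1\<close>, and let
  \<open>E\<close> be the event that the \<open>j\<close>-th sign of the local minimum \<open>ell 0\<close> is \<open>1\<close>. Let \<open>K\<close> be the
  \<sigma>-algebra generated by the path, the enumeration of its local minima, all signs except this one,
  and the events of probability 0 or 1. By the product form of the joint law, \<open>E\<close> is independent of
  \<open>K\<close> (\<open>indep_sign_other_events\<close>).

  The marginal on \<open>S\<close> is \<open>K\<close>-measurable. If the full permuton \<open>\<mu>\<close> were almost surely a measurable
  function of that marginal, then so would be the number
  \<open>G = \<integral> x\<^sub>1 x\<^sub>\<kappa> d\<mu> = \<integral> t \<psi>\<^sup>j(t) dt\<close>, which would thus be \<open>K\<close>-measurable. Let \<open>R\<close> be the same integral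
  with the sign of \<open>ell 0\<close> replaced by \<open>- 1\<close>; it is \<open>K\<close>-measurable by construction. Two points whose
  interval has its minimum at \<open>ell 0\<close> are ordered from left to right if the sign there is \<open>1\<close> and
  from right to left if it is \<open>- 1\<close>. Hence changing the sign from \<open>1\<close> to \<open>- 1\<close> lowers the ranks on
  the right of \<open>ell 0\<close>, raises those on the left, and makes the integral strictly smaller
  (\<open>integral_flip\<close>). Therefore \<open>E\<close> agrees up to a null set with the event \<open>R < G\<close>, which
  belongs to \<open>K\<close>. So \<open>E\<close> is independent of itself and its probability \<open>p j\<close> is 0 or 1, a
  contradiction.

  Two points need work. First, a function on a space of permutons can only be used at permutons, so the
  random measures have to have uniform marginals: \<open>\<psi>\<close> is the rank function of an order that is total off a null set,
  and in an atomless probability space the rank of a random point is uniform (\<open>rank_uniform\<close>). Second, the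
  marginal has to be measurable for the Borel sets of the weak topology, although these are generated by
  uncountably many open sets. Here every weakly open set of permutons is the preimage of an open set
  under the sequence of masses of countably many grid cells (\<open>weak_open_cell_masses\<close>), and these
  masses are measurable functions of the path and the signs (\<open>measurable_permuton_on\<close>).
\<close>

section \<open>Ranks in a measurable total order are uniform\<close>

text \<open>Averaged over \<open>A\<close>, the mass below a point and the mass above it are equal by Fubini, and together
  they make up all of \<open>A\<close>; so the mass below cannot exceed one half everywhere.\<close>
lemma (in prob_space) exists_small_rank:
  fixes R :: "'a \<Rightarrow> 'a \<Rightarrow> bool"
  assumes R [measurable]: "Measurable.pred (M \<Otimes>\<^sub>M M) (\<lambda>(x, y). R x y)"
    and A [measurable]: "A \<in> sets M" and pos: "prob A > 0"
    and points: "\<And>x. x \<in> space M \<Longrightarrow> {x} \<in> null_sets M"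
    and total: "\<And>x y. x \<in> A \<Longrightarrow> y \<in> A \<Longrightarrow> x \<noteq> y \<Longrightarrow> R y x \<longleftrightarrow> \<not> R x y"
  shows "\<exists>t\<in>A. prob {x\<in>A. R x t} \<le> prob A / 2"
proof (rule ccontr)
  interpret PP: pair_prob_space M M ..
  assume "\<not> ?thesis"
  then have big: "prob {x\<in>A. R x t} > prob A / 2" if "t \<in> A" for t
    using that by (auto simp: not_le)
  have As: "A \<subseteq> space M" using A by (rule sets.sets_into_space)
  have m1: "{x \<in> A. R x t} \<in> sets M" "{x \<in> A. R t x} \<in> sets M" if "t \<in> A" for t
  proof -
    have [measurable]: "t \<in> space M" using that As by auto
    have eq: "{x \<in> A. R x t} = {x \<in> space M. x \<in> A \<and> R x t}" "{x \<in> A. R t x} = {x \<in> space M. x \<in> A \<and> R t x}"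
      using As by auto
    show "{x \<in> A. R x t} \<in> sets M" "{x \<in> A. R t x} \<in> sets M"
      unfolding eq by measurable
  qed
  have split: "prob {x\<in>A. R t x} = prob A - prob {x\<in>A. R x t}" if t: "t \<in> A" for t
  proof -
    have null: "{t} \<in> null_sets M" using points t As by auto
    let ?L = "{x\<in>A. R x t} - {t}" and ?R = "{x\<in>A. R t x} - {t}"
    have "prob A = prob (A - {t})"
      using null by (simp add: measure_Diff_null_set)
    also have "A - {t} = ?L \<union> ?R"
      using total t by auto
    also have "prob (?L \<union> ?R) = prob ?L + prob ?R"
      using m1 t null total by (intro finite_measure_Union sets.Diff) auto
    also have "prob ?L = prob {x\<in>A. R x t}"
      using m1 t null by (simp add: measure_Diff_null_set)
    also have "prob ?R = prob {x\<in>A. R t x}"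
      using m1 t null by (simp add: measure_Diff_null_set)
    finally show ?thesis by simp
  qed
  have Rm [measurable]: "Measurable.pred N (\<lambda>z. R (f z) (g z))"
    if "f \<in> measurable N M" "g \<in> measurable N M" for f g and N :: "'c measure"
    using measurable_compose[OF measurable_Pair[OF that] R] by simp
  let ?ir = "\<lambda>x t. indicator A x * indicator A t * (if R x t then 1 else 0) :: real"
  define r where "r t = (\<integral>x. ?ir x t \<partial>M)" for t
  define a where "a t = (\<integral>x. ?ir t x \<partial>M)" for t
  have r: "r t = prob {x\<in>A. R x t}" and a: "a t = prob {x\<in>A. R t x}" if "t \<in> A" for t
  proof -
    have "r t = (\<integral>x. indicator {x\<in>A. R x t} x \<partial>M)" "a t = (\<integral>x. indicator {x\<in>A. R t x} x \<partial>M)"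
      unfolding r_def a_def using that by (auto intro!: Bochner_Integration.integral_cong simp: indicator_def)
    moreover have "{x \<in> A. R x t} \<inter> space M = {x \<in> A. R x t}" "{x \<in> A. R t x} \<inter> space M = {x \<in> A. R t x}"
      using As by auto
    ultimately show "r t = prob {x\<in>A. R x t}" "a t = prob {x\<in>A. R t x}" by simp_all
  qed
  have out: "r t = 0" "a t = 0" if "t \<notin> A" for t
    using that unfolding r_def a_def by simp_all
  have int1: "integrable (M \<Otimes>\<^sub>M M) (\<lambda>(x, t). ?ir x t)"
    by (rule PP.integrable_const_bound[where B=1]) (auto simp: indicator_def intro!: AE_I2)
  have eq: "(\<integral>t. r t \<partial>M) = (\<integral>t. a t \<partial>M)"
    unfolding r_def a_def by (rule PP.Fubini_integral[OF int1])
  have [measurable]: "r \<in> borel_measurable M" "a \<in> borel_measurable M"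
    unfolding r_def a_def by measurable
  have bd: "\<bar>r t\<bar> \<le> 1" "\<bar>a t\<bar> \<le> 1" for t
    by (cases "t \<in> A"; simp add: r a out)+
  have ir: "integrable M r" "integrable M a"
    using bd by (auto intro!: integrable_const_bound[where B=1])
  have pos': "0 < r t - a t" if "t \<in> A" for t
    using big[OF that] split[OF that] r[OF that] a[OF that] by simp
  have "AE t in M. r t - a t = 0"
  proof (subst integral_nonneg_eq_0_iff_AE[symmetric])
    have "0 \<le> r t - a t" for t
      using pos'[of t] out[of t] by (cases "t \<in> A") auto
    then show "AE t in M. 0 \<le> r t - a t" by simp
  qed (use ir eq in auto)
  then have "AE t in M. t \<notin> A"
    by eventually_elim (use pos' in force)
  then have "prob A = 0"
    using A by (metis AE_iff_null_sets measure_eq_0_null_sets)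
  with pos show False by simp
qed

text \<open>The proof is by halving: if all ranks inside \<open>A\<close> were at least \<open>c\<close>, the points of \<open>A\<close> below a
  suitable point would form a set of at most half the mass whose points, by transitivity, have the same
  ranks as before. Repeating this gives sets of mass at least \<open>c\<close> and arbitrarily small.\<close>
lemma (in prob_space) rank_not_bounded_below:
  fixes R :: "'a \<Rightarrow> 'a \<Rightarrow> bool"
  assumes R [measurable]: "Measurable.pred (M \<Otimes>\<^sub>M M) (\<lambda>(x, y). R x y)"
    and A: "A \<in> sets M" and pos: "prob A > 0"
    and points: "\<And>x. x \<in> space M \<Longrightarrow> {x} \<in> null_sets M"
    and total: "\<And>x y. x \<in> A \<Longrightarrow> y \<in> A \<Longrightarrow> x \<noteq> y \<Longrightarrow> R y x \<longleftrightarrow> \<not> R x y"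
    and trans: "\<And>x y z. x \<in> A \<Longrightarrow> y \<in> A \<Longrightarrow> z \<in> A \<Longrightarrow> R x y \<Longrightarrow> R y z \<Longrightarrow> R x z"
    and c: "c > 0"
  shows "\<exists>t\<in>A. prob {x\<in>A. R x t} < c"
proof (rule ccontr)
  assume "\<not> ?thesis"
  then have big: "c \<le> prob {x\<in>A. R x t}" if "t \<in> A" for t
    using that by (auto simp: not_less)
  have As: "A \<subseteq> space M" using A by (rule sets.sets_into_space)
  have "\<exists>B\<subseteq>A. B \<in> sets M \<and> prob B > 0 \<and> prob B \<le> (1/2)^n \<and> (\<forall>t\<in>B. c \<le> prob {x\<in>B. R x t})" for n
  proof (induction n)
    case 0
    show ?case using A pos big by (intro exI[of _ A]) auto
  next
    case (Suc n)
    then obtain B where B: "B \<subseteq> A" "B \<in> sets M" "prob B > 0" "prob B \<le> (1/2)^n"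
      "\<And>t. t \<in> B \<Longrightarrow> c \<le> prob {x\<in>B. R x t}" by auto
    obtain t where t: "t \<in> B" "prob {x\<in>B. R x t} \<le> prob B / 2"
      using exists_small_rank[OF R B(2,3) points] total B(1) by blast
    let ?C = "{x\<in>B. R x t}"
    have C: "?C \<in> sets M"
    proof -
      have "t \<in> space M" using t B As by auto
      then have "Measurable.pred M (\<lambda>x. R x t)"
        using measurable_compose[OF measurable_Pair[OF measurable_ident measurable_const] R] by simp
      then have "{x \<in> space M. x \<in> B \<and> R x t} \<in> sets M"
        using B(2) by measurable
      also have "{x \<in> space M. x \<in> B \<and> R x t} = ?C" using B As by auto
      finally show ?thesis .
    qed
    have "{x\<in>?C. R x u} = {x\<in>B. R x u}" if "u \<in> ?C" for u
      using that trans t B(1) by blast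
    then have "c \<le> prob {x\<in>?C. R x u}" if "u \<in> ?C" for u
      using B(5)[of u] that by simp
    moreover have "prob ?C > 0" using B(5)[OF t(1)] c by linarith
    ultimately show ?case using B(1,4) t C by (intro exI[of _ ?C]) auto
  qed note small = this
  obtain n where n: "(1/2)^n < c" using c real_arch_pow_inv[of c "1/2"] by auto
  obtain B where B: "B \<subseteq> A" "B \<in> sets M" "prob B > 0" "prob B \<le> (1/2)^n"
      "\<And>t. t \<in> B \<Longrightarrow> c \<le> prob {x\<in>B. R x t}" using small[of n] by auto
  then obtain t where "t \<in> B" by fastforce
  then have "c \<le> prob {x\<in>B. R x t}" using B by blast
  also have "\<dots> \<le> prob B" using B(2) by (intro finite_measure_mono) auto
  finally show False using B n by linarith
qed

text \<open>Let \<open>D\<close> be the set of points of rank at most \<open>u\<close>. If its mass were below \<open>u\<close>, the points outside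
  \<open>D\<close> would have ranks bounded below inside the complement of \<open>D\<close>; if it were above \<open>u\<close>, the points of
  \<open>D\<close> would have, for the reversed order, ranks bounded below inside \<open>D\<close>. Both contradict
  \<open>rank_not_bounded_below\<close>. The set \<open>G\<close> allows the order to be degenerate on a null set.\<close>
lemma (in prob_space) rank_uniform:
  fixes R :: "'a \<Rightarrow> 'a \<Rightarrow> bool"
  assumes R [measurable]: "Measurable.pred (M \<Otimes>\<^sub>M M) (\<lambda>(x, y). R x y)"
    and points: "\<And>x. x \<in> space M \<Longrightarrow> {x} \<in> null_sets M"
    and G: "G \<in> sets M" "prob G = 1"
    and total: "\<And>x y. x \<in> G \<Longrightarrow> y \<in> G \<Longrightarrow> x \<noteq> y \<Longrightarrow> R y x \<longleftrightarrow> \<not> R x y"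
    and trans: "\<And>x y z. x \<in> G \<Longrightarrow> y \<in> G \<Longrightarrow> z \<in> G \<Longrightarrow> R x y \<Longrightarrow> R y z \<Longrightarrow> R x z"
    and u: "0 \<le> u" "u \<le> 1"
  shows "prob {t\<in>space M. prob {x\<in>space M. R x t} \<le> u} = u"
proof -
  have Rm [measurable]: "Measurable.pred N (\<lambda>z. R (f z) (g z))"
    if "f \<in> measurable N M" "g \<in> measurable N M" for f g and N :: "'c measure"
    using measurable_compose[OF measurable_Pair[OF that] R] by simp
  have Gs: "G \<subseteq> space M" using G by (auto dest: sets.sets_into_space)
  have AEG: "AE x in M. x \<in> G" using G by (simp add: prob_eq_1)
  let ?r = "\<lambda>t. prob {x\<in>space M. R x t}"
  have rm [measurable]: "?r \<in> borel_measurable M" by measurable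
  define D where "D = {t\<in>G. ?r t \<le> u}"
  have "{t \<in> space M. t \<in> G \<and> ?r t \<le> u} \<in> sets M" using G(1) by measurable
  also have "{t \<in> space M. t \<in> G \<and> ?r t \<le> u} = D" using Gs by (auto simp: D_def)
  finally have D [measurable]: "D \<in> sets M" .
  have m1: "{x \<in> A. R x t} \<in> sets M" "{x \<in> A. R t x} \<in> sets M" if A: "A \<in> sets M" "t \<in> G" for A t
  proof -
    have [measurable]: "t \<in> space M" "A \<in> sets M" using that Gs by auto
    have eq: "{x \<in> A. R x t} = {x \<in> space M. x \<in> A \<and> R x t}" "{x \<in> A. R t x} = {x \<in> space M. x \<in> A \<and> R t x}"
      using sets.sets_into_space[OF A(1)] by auto
    show "{x \<in> A. R x t} \<in> sets M" "{x \<in> A. R t x} \<in> sets M"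
      unfolding eq by measurable
  qed
  have GD: "G - D \<in> sets M" using G D by auto
  have probGD: "prob (G - D) = 1 - prob D"
    using G D by (subst finite_measure_Diff) (auto simp: D_def)
  have "\<not> prob D < u"
  proof
    assume less: "prob D < u"
    have "\<exists>t\<in>G - D. prob {x\<in>G - D. R x t} < u - prob D"
    proof (rule rank_not_bounded_below[OF R GD _ points])
      show "0 < prob (G - D)" using less u probGD by simp
      show "0 < u - prob D" using less by simp
      show "R y x \<longleftrightarrow> \<not> R x y" if "x \<in> G - D" "y \<in> G - D" "x \<noteq> y" for x y
        using total that by blast
      show "R x z" if "x \<in> G - D" "y \<in> G - D" "z \<in> G - D" "R x y" "R y z" for x y z
        using trans[of x y z] that by blast
    qed
    then obtain t where t: "t \<in> G" "t \<notin> D" "prob {x\<in>G - D. R x t} < u - prob D" by blast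
    have "?r t = prob ({x\<in>D. R x t} \<union> {x\<in>G - D. R x t})"
    proof (rule finite_measure_eq_AE)
      show "AE x in M. (x \<in> {x \<in> space M. R x t}) = (x \<in> {x\<in>D. R x t} \<union> {x\<in>G - D. R x t})"
        using AEG by eventually_elim (use Gs in \<open>auto simp: D_def\<close>)
      show "{x \<in> space M. R x t} \<in> sets M" using m1(1)[OF sets.top t(1)] .
      show "{x\<in>D. R x t} \<union> {x\<in>G - D. R x t} \<in> sets M" using m1(1)[OF D t(1)] m1(1)[OF GD t(1)] by (rule sets.Un)
    qed
    also have "\<dots> \<le> prob {x\<in>D. R x t} + prob {x\<in>G - D. R x t}"
      using t D GD by (intro measure_Un_le m1)
    also have "prob {x\<in>D. R x t} \<le> prob D"
      using D by (intro finite_measure_mono) auto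
    finally have "?r t < u" using t by simp
    then show False using t by (simp add: D_def)
  qed
  moreover have "\<not> prob D > u"
  proof
    assume more: "prob D > u"
    have "\<exists>t\<in>D. prob {x\<in>D. R t x} < prob D - u"
    proof (rule rank_not_bounded_below[OF _ D _ points])
      show "Measurable.pred (M \<Otimes>\<^sub>M M) (\<lambda>(x, y). R y x)" by measurable
      show "0 < prob D" using more u by simp
      show "0 < prob D - u" using more by simp
      show "R x y \<longleftrightarrow> \<not> R y x" if "x \<in> D" "y \<in> D" "x \<noteq> y" for x y
        using total[of y x] that by (simp add: D_def)
      show "R z x" if "x \<in> D" "y \<in> D" "z \<in> D" "R y x" "R z y" for x y z
        using trans[of z y x] that by (simp add: D_def)
    qed
    then obtain t where t: "t \<in> D" "prob {x\<in>D. R t x} < prob D - u" by blast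
    have tG: "t \<in> G" using t by (simp add: D_def)
    have "prob D = prob ({x\<in>D. R x t} \<union> {x\<in>D. R t x})"
    proof (rule finite_measure_eq_AE)
      have "AE x in M. x \<noteq> t"
        using points[of t] tG Gs by (intro AE_I'[of "{t}"]) auto
      then show "AE x in M. (x \<in> D) = (x \<in> {x\<in>D. R x t} \<union> {x\<in>D. R t x})"
        by eventually_elim (use total tG in \<open>auto simp: D_def\<close>)
    qed (use D tG m1 in auto)
    also have "\<dots> \<le> prob {x\<in>D. R x t} + prob {x\<in>D. R t x}"
      using D tG by (intro measure_Un_le m1)
    also have "prob {x\<in>D. R x t} \<le> ?r t"
      using Gs m1(1)[OF sets.top tG] by (intro finite_measure_mono) (auto simp: D_def)
    finally have "?r t > u" using t by simp
    then show False using t by (simp add: D_def)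
  qed
  ultimately have "prob D = u" by simp
  moreover have "prob {t\<in>space M. ?r t \<le> u} = prob D"
  proof (rule finite_measure_eq_AE)
    show "AE t in M. (t \<in> {t \<in> space M. ?r t \<le> u}) = (t \<in> D)"
      using AEG by eventually_elim (use Gs in \<open>auto simp: D_def\<close>)
    show "{t \<in> space M. ?r t \<le> u} \<in> sets M" by measurable
  qed (rule D)
  ultimately show ?thesis by simp
qed

section \<open>The order defined by a path and its signs\<close>

abbreviation unif :: "real measure" where
  "unif \<equiv> restrict_space lborel {0..1}"

text \<open>The wings of \<open>l\<close> are the sets of points \<open>x\<close> to its left and \<open>y\<close> to its right such that the pairs
  \<open>(x, y)\<close> are exactly those whose unique minimum is attained at \<open>l\<close>, in the interior. Being intervals, they
  are Borel sets for an arbitrary path, so the induced order is a countable union of measurable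
  rectangles as soon as there are only countably many local minima.\<close>
definition left_wing :: "(real \<Rightarrow> real) \<Rightarrow> real \<Rightarrow> real set" where
  "left_wing f l = {x. x < l \<and> (\<forall>u\<in>{x..<l}. f l < f u)}"

definition right_wing :: "(real \<Rightarrow> real) \<Rightarrow> real \<Rightarrow> real set" where
  "right_wing f l = {y. l < y \<and> (\<forall>u\<in>{l<..y}. f l < f u)}"

lemma interior_unique_minimum_iff:
  "l \<in> {x<..<y} \<and> unique_minimum_at f x y l \<longleftrightarrow> x \<in> left_wing f l \<and> y \<in> right_wing f l"
  unfolding unique_minimum_at_def left_wing_def right_wing_def
  by (auto simp: Ball_def) (metis linorder_neqE_linordered_idom)

lemma borel_wings [measurable]: "left_wing f l \<in> sets borel" "right_wing f l \<in> sets borel"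
proof -
  have "is_interval (left_wing f l)" "is_interval (right_wing f l)"
    unfolding is_interval_1 left_wing_def right_wing_def by auto
  then show "left_wing f l \<in> sets borel" "right_wing f l \<in> sets borel"
    by (auto intro: real_interval_borel_measurable)
qed

lemma unique_minimum_at_unique:
  "unique_minimum_at f x y l \<Longrightarrow> unique_minimum_at f x y l' \<Longrightarrow> l = l'"
  unfolding unique_minimum_at_def by (metis DiffI insert_iff order_less_asym singletonD)

lemma wings_local_minimum:
  assumes "x \<in> left_wing f l" "y \<in> right_wing f l" "0 \<le> x" "y \<le> 1"
  shows "l \<in> local_minima f"
proof -
  have xy: "x < l" "l < y" using assms by (auto simp: left_wing_def right_wing_def)
  have "\<forall>\<^sub>F u in at l. u \<in> {x<..<y}"
    using xy by (intro eventually_at_in_open') auto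
  then have "\<forall>\<^sub>F u in at l. f l \<le> f u"
  proof eventually_elim
    case (elim u)
    then show ?case using assms xy
      by (cases u l rule: linorder_cases) (auto simp: left_wing_def right_wing_def less_imp_le)
  qed
  then show ?thesis using assms xy by (auto simp: local_minima_def)
qed

lemma positive_at_minimum_iff:
  assumes "0 \<le> x" "y \<le> 1"
  shows "positive_at_minimum f g x y \<longleftrightarrow>
    (\<exists>l\<in>{l\<in>local_minima f. g l = 1}. x \<in> left_wing f l \<and> y \<in> right_wing f l)"
  using assms wings_local_minimum[of x f _ y]
  unfolding positive_at_minimum_def by (metis (mono_tags, lifting) interior_unique_minimum_iff mem_Collect_eq)

lemma prob_space_unif: "prob_space unif"
  by (rule prob_spaceI) (simp add: emeasure_restrict_space)

interpretation unif: prob_space unif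
  by (rule prob_space_unif)

lemma measurable_excursion_less:
  assumes L: "countable (local_minima f)"
  shows "Measurable.pred (unif \<Otimes>\<^sub>M unif) (\<lambda>(x, t). excursion_less f g x t)"
proof -
  have [measurable]: "(\<lambda>x. x) \<in> borel_measurable unif"
    by (intro measurable_restrict_space1) simp
  have C: "countable {l\<in>local_minima f. g l = 1}"
    by (rule countable_subset[OF _ L]) auto
  have "Measurable.pred (unif \<Otimes>\<^sub>M unif) (\<lambda>z.
      (fst z < snd z \<and> (\<exists>l\<in>{l\<in>local_minima f. g l = 1}. fst z \<in> left_wing f l \<and> snd z \<in> right_wing f l)) \<or>
      (snd z < fst z \<and> \<not> (\<exists>l\<in>{l\<in>local_minima f. g l = 1}. snd z \<in> left_wing f l \<and> fst z \<in> right_wing f l)))"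
    using C by measurable
  also have "?this \<longleftrightarrow> Measurable.pred (unif \<Otimes>\<^sub>M unif) (\<lambda>(x, t). excursion_less f g x t)"
    by (intro measurable_cong)
       (auto simp: space_pair_measure excursion_less_def positive_at_minimum_iff)
  finally show ?thesis .
qed

lemma unif_points: "x \<in> space unif \<Longrightarrow> {x} \<in> null_sets unif"
  by (auto simp: null_sets_restrict_space)

lemma psi_eq_rank:
  assumes L: "countable (local_minima f)" and t: "t \<in> {0..1}"
  shows "psi f g t = measure unif {x\<in>space unif. excursion_less f g x t}"
proof -
  have t': "t \<in> space unif" using t by simp
  have "Measurable.pred unif (\<lambda>x. excursion_less f g x t)"
    using measurable_compose[OF measurable_Pair[OF measurable_ident measurable_const[OF t']]
        measurable_excursion_less[OF L, of g]] by simp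
  then have m: "{x\<in>space unif. excursion_less f g x t} \<in> sets unif" by (rule predE)
  then have "{x\<in>{0..1}. excursion_less f g x t} \<in> sets borel"
    by (simp add: sets_restrict_space_iff)
  then show ?thesis using m
    unfolding psi_def by (subst measure_restrict_space) (auto simp: measure_completion)
qed

lemma measurable_psi:
  assumes L: "countable (local_minima f)"
  shows "psi f g \<in> borel_measurable unif"
proof -
  note [measurable] = measurable_excursion_less[OF L, of g]
  have "Measurable.pred (unif \<Otimes>\<^sub>M unif) (\<lambda>z. excursion_less f g (snd z) (fst z))"
    using measurable_compose[OF measurable_pair_swap' measurable_excursion_less[OF L, of g]]
    by (simp add: case_prod_beta)
  then have Q: "{z \<in> space (unif \<Otimes>\<^sub>M unif). excursion_less f g (snd z) (fst z)} \<in> sets (unif \<Otimes>\<^sub>M unif)" (is "?Q \<in> _")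
    by (rule predE)
  have "(\<lambda>t. enn2real (emeasure unif (Pair t -` ?Q))) \<in> borel_measurable unif"
    using unif.measurable_emeasure_Pair[OF Q] by measurable
  moreover have "Pair t -` ?Q = {x\<in>space unif. excursion_less f g x t}" if "t \<in> space unif" for t
    using that by (auto simp: space_pair_measure)
  ultimately have "(\<lambda>t. measure unif {x\<in>space unif. excursion_less f g x t}) \<in> borel_measurable unif"
    by (subst measurable_cong[where g="\<lambda>t. enn2real (emeasure unif (Pair t -` ?Q))"]) (simp_all only: measure_def)
  then show ?thesis
    by (subst measurable_cong[OF psi_eq_rank[OF L]]) auto
qed

lemma psi_in_unit:
  assumes "countable (local_minima f)" "t \<in> {0..1}"
  shows "psi f g t \<in> {0..1}"
  using psi_eq_rank[OF assms, of g] by simp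

text \<open>The almost sure property of the excursion, for a given exceptional set, from which the
  transitivity of the induced order is derived.\<close>
definition unique_minima_off :: "(real \<Rightarrow> real) \<Rightarrow> real set \<Rightarrow> bool" where
  "unique_minima_off f N \<longleftrightarrow> (\<forall>x \<in> {0..1} - N. \<forall>y \<in> {0..1} - N. x < y \<longrightarrow>
        (\<exists>l \<in> local_minima f. unique_minimum_at f x y l))"

lemma excursion_less_total:
  "x \<noteq> y \<Longrightarrow> excursion_less f g y x \<longleftrightarrow> \<not> excursion_less f g x y"
  by (auto simp: excursion_less_def)

lemma excursion_less_irrefl: "\<not> excursion_less f g x x"
  by (auto simp: excursion_less_def)

text \<open>The minimum over \<open>[x, z]\<close> is the minimum over one of \<open>[x, y]\<close> and \<open>[y, z]\<close>. This is the only property of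
  the signs of pairs behind transitivity: a cycle of three points would need the pair of outer points to
  carry a sign different from that of both other pairs.\<close>
lemma positive_at_minimum_concat:
  assumes "x < y" "y < z"
    and xy: "\<exists>l\<in>{x<..<y}. unique_minimum_at f x y l" and yz: "\<exists>l\<in>{y<..<z}. unique_minimum_at f y z l"
    and xz: "\<exists>l\<in>{x<..<z}. unique_minimum_at f x z l"
  shows "positive_at_minimum f g x z = positive_at_minimum f g x y \<or>
    positive_at_minimum f g x z = positive_at_minimum f g y z"
proof -
  obtain a b c where a: "a \<in> {x<..<y}" "unique_minimum_at f x y a"
    and b: "b \<in> {y<..<z}" "unique_minimum_at f y z b"
    and c: "c \<in> {x<..<z}" "unique_minimum_at f x z c"
    using xy yz xz by auto
  have val: "positive_at_minimum f g x y \<longleftrightarrow> g a = 1" "positive_at_minimum f g y z \<longleftrightarrow> g b = 1"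
    "positive_at_minimum f g x z \<longleftrightarrow> g c = 1"
    unfolding positive_at_minimum_def using a b c unique_minimum_at_unique by blast+
  have "c = a \<or> c = b"
  proof (cases "c \<le> y")
    case True
    then have "unique_minimum_at f x y c"
      using c assms unfolding unique_minimum_at_def by auto
    then show ?thesis using a unique_minimum_at_unique by blast
  next
    case False
    then have "unique_minimum_at f y z c"
      using c assms unfolding unique_minimum_at_def by auto
    then show ?thesis using b unique_minimum_at_unique by blast
  qed
  with val show ?thesis by auto
qed

lemma excursion_less_trans:
  assumes N: "unique_minima_off f N" "local_minima f \<subseteq> N"
    and pts: "x \<in> {0..1} - N" "y \<in> {0..1} - N" "z \<in> {0..1} - N"
    and less: "excursion_less f g x y" "excursion_less f g y z"
  shows "excursion_less f g x z"
proof -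
  have min: "\<exists>l\<in>{a<..<b}. unique_minimum_at f a b l" if "a \<in> {0..1} - N" "b \<in> {0..1} - N" "a < b" for a b
  proof -
    have "\<exists>l \<in> local_minima f. unique_minimum_at f a b l"
      using N(1)[unfolded unique_minima_off_def, rule_format, OF that] .
    then obtain l where l: "l \<in> local_minima f" "unique_minimum_at f a b l"
      by blast
    moreover have "l \<noteq> a" "l \<noteq> b" using l N(2) that by auto
    ultimately show ?thesis by (auto simp: unique_minimum_at_def intro!: bexI[of _ l])
  qed
  have cc: "positive_at_minimum f g a c = positive_at_minimum f g a b \<or>
    positive_at_minimum f g a c = positive_at_minimum f g b c"
    if "a \<in> {0..1} - N" "b \<in> {0..1} - N" "c \<in> {0..1} - N" "a < b" "b < c" for a b c
    by (rule positive_at_minimum_concat[OF that(4,5) min[OF that(1,2,4)] min[OF that(2,3,5)]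
          min[OF that(1,3) less_trans[OF that(4,5)]]])
  have ne: "x \<noteq> y" "y \<noteq> z" using less excursion_less_irrefl by auto
  have "x \<noteq> z" using less excursion_less_total[of x y f g] ne by auto
  then consider "x<y" "y<z" | "x<z" "z<y" | "y<x" "x<z" | "y<z" "z<x" | "z<x" "x<y" | "z<y" "y<x"
    using ne by linarith
  then show ?thesis
    by cases (use less pts cc[of x y z] cc[of x z y] cc[of y x z] cc[of y z x] cc[of z x y] cc[of z y x]
        in \<open>auto simp: excursion_less_def\<close>)
qed

lemma psi_uniform:
  assumes L: "countable (local_minima f)" and N: "N \<in> null_sets lborel" "unique_minima_off f N"
  shows "distr unif (restrict_space borel {0..1}) (psi f g) = unif"
proof -
  let ?N = "N \<union> local_minima f"
  have [measurable]: "psi f g \<in> borel_measurable unif" by (rule measurable_psi[OF L])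
  have "local_minima f \<in> null_sets lborel"
    using L by (rule countable_imp_null_set_lborel)
  then have nN: "?N \<in> null_sets lborel" using N(1) by (rule null_sets.Un[rotated])
  have off: "unique_minima_off f ?N" using N(2) by (auto simp: unique_minima_off_def)
  have cdf_psi: "measure unif {t\<in>space unif. psi f g t \<le> u} = u" if u: "0 \<le> u" "u \<le> 1" for u
  proof -
    have "measure unif {t\<in>space unif. measure unif {x\<in>space unif. excursion_less f g x t} \<le> u} = u"
    proof (rule unif.rank_uniform[where G="{0..1} - ?N"])
      show "{0..1} - ?N \<in> sets unif"
        using nN by (auto simp: sets_restrict_space_iff)
      show "measure unif ({0..1} - ?N) = 1"
        using nN by (subst measure_restrict_space) (auto simp: measure_Diff_null_set)
      show "excursion_less f g x z" if "x \<in> {0..1} - ?N" "y \<in> {0..1} - ?N" "z \<in> {0..1} - ?N"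
          "excursion_less f g x y" "excursion_less f g y z" for x y z
        using excursion_less_trans[OF off _ that] by blast
    qed (rule measurable_excursion_less[OF L] unif_points excursion_less_total u; assumption?)+
    moreover have "{t\<in>space unif. psi f g t \<le> u} =
        {t\<in>space unif. measure unif {x\<in>space unif. excursion_less f g x t} \<le> u}"
      using psi_eq_rank[OF L] by auto
    ultimately show ?thesis by simp
  qed
  have idm [measurable]: "(\<lambda>x. x) \<in> borel_measurable unif"
    by (intro measurable_restrict_space1) simp
  have "distr unif borel (psi f g) = distr unif borel (\<lambda>x. x)"
  proof (rule cdf_unique)
    show "real_distribution (distr unif borel (psi f g))" "real_distribution (distr unif borel (\<lambda>x. x))"
      by (auto intro!: unif.real_distribution_distr)
    show "cdf (distr unif borel (psi f g)) = cdf (distr unif borel (\<lambda>x. x))"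
    proof
      fix u :: real
      have *: "cdf (distr unif borel (psi f g)) u = measure unif {t\<in>space unif. psi f g t \<le> u}"
        unfolding cdf_def by (subst measure_distr) (auto intro!: arg_cong[where f="measure unif"])
      have **: "cdf (distr unif borel (\<lambda>x. x)) u = measure lborel {0..min u 1}"
        unfolding cdf_def by (subst measure_distr, simp, simp, subst measure_restrict_space)
          (auto intro!: arg_cong[where f="measure lborel"])
      consider "u < 0" | "0 \<le> u" "u \<le> 1" | "1 < u" by linarith
      then show "cdf (distr unif borel (psi f g)) u = cdf (distr unif borel (\<lambda>x. x)) u"
      proof cases
        case 1
        then have "{t\<in>space unif. psi f g t \<le> u} = {}" using psi_in_unit[OF L, of _ g] by fastforce
        then show ?thesis using 1 unfolding * ** by (simp only:) simp
      next
        case 2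
        then show ?thesis unfolding * ** cdf_psi[OF 2] by simp
      next
        case 3
        then have "{t\<in>space unif. psi f g t \<le> u} = space unif" using psi_in_unit[OF L, of _ g] by fastforce
        then show ?thesis using 3 unif.prob_space unfolding * ** by simp
      qed
    qed
  qed
  note eq = this
  show ?thesis
  proof (rule measure_eqI)
    fix A assume "A \<in> sets (distr unif (restrict_space borel {0..1}) (psi f g))"
    then have A: "A \<in> sets (restrict_space borel {0..1})" by simp
    then have A': "A \<in> sets borel" "A \<subseteq> {0..1}" by (auto simp: sets_restrict_space_iff)
    have pm: "psi f g \<in> measurable unif (restrict_space borel {0..1})"
      using psi_in_unit[OF L, of _ g] by (intro measurable_restrict_space2) auto
    have "emeasure (distr unif (restrict_space borel {0..1}) (psi f g)) A = emeasure (distr unif borel (psi f g)) A"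
      using A A' pm by (simp add: emeasure_distr)
    also have "\<dots> = emeasure unif A"
      unfolding eq using A' by (simp add: emeasure_distr Int_absorb2)
    finally show "emeasure (distr unif (restrict_space borel {0..1}) (psi f g)) A = emeasure unif A" .
  qed (simp add: sets_restrict_space)
qed

section \<open>Permutons defined by a path and its signs\<close>

text \<open>For \<open>S = {1..d}\<close> this is the separable permuton; for subsets it is its marginal. Lebesgue measure is taken
  on Borel sets, so that product measures and Fubini apply directly.\<close>
definition permuton_on :: "nat set \<Rightarrow> (real \<Rightarrow> real) \<Rightarrow> (nat \<Rightarrow> real \<Rightarrow> int) \<Rightarrow> (nat \<Rightarrow> real) measure" where
  "permuton_on S f g = distr unif (cube S)
    (\<lambda>t. \<lambda>k\<in>S. if k = 1 then t else psi f (g (k - 1)) t)"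

lemma coordinates_measurable:
  assumes L: "countable (local_minima f)"
  shows "(\<lambda>t. if k = 1 then t else psi f (g (k - 1)) t) \<in> measurable unif (restrict_space borel {0..1})"
proof (rule measurable_restrict_space2)
  have "(\<lambda>t. t) \<in> borel_measurable unif"
    by (intro measurable_restrict_space1) simp
  then show "(\<lambda>t. if k = 1 then t else psi f (g (k - 1)) t) \<in> borel_measurable unif"
    using measurable_psi[OF L] by simp
  show "(\<lambda>t. if k = 1 then t else psi f (g (k - 1)) t) \<in> space unif \<rightarrow> {0..1}"
    using psi_in_unit[OF L] by simp
qed

lemma permuton_map_measurable:
  assumes L: "countable (local_minima f)"
  shows "(\<lambda>t. \<lambda>k\<in>S. if k = 1 then t else psi f (g (k - 1)) t) \<in> measurable unif (cube S)"
  unfolding cube_def by (intro measurable_restrict coordinates_measurable[OF L])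

lemma separable_permuton_eq:
  assumes L: "countable (local_minima f)"
  shows "separable_permuton d f g = permuton_on {1..d} f g"
proof (rule measure_eqI)
  let ?h = "\<lambda>t. \<lambda>k\<in>{1..d}. if k = 1 then t else psi f (g (k - 1)) t"
  note m = permuton_map_measurable[OF L, of g "{1..d}"]
  have m': "?h \<in> measurable (lebesgue_on {0..1}) (cube {1..d})"
  proof -
    have "(\<lambda>t. t) \<in> measurable (lebesgue_on {0..1}) unif"
      by (rule measurable_restrict_space3) (auto simp: measurable_completion)
    from measurable_compose[OF this m] show ?thesis by simp
  qed
  fix A assume "A \<in> sets (separable_permuton d f g)"
  then have A: "A \<in> sets (cube {1..d})" by (simp add: separable_permuton_def)
  have B: "?h -` A \<inter> {0..1} \<in> sets borel"
    using measurable_sets[OF m A] by (simp add: sets_restrict_space_iff)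
  have "emeasure (separable_permuton d f g) A = emeasure (lebesgue_on {0..1}) (?h -` A \<inter> {0..1})"
    unfolding separable_permuton_def using A m' by (simp add: emeasure_distr)
  also have "\<dots> = emeasure unif (?h -` A \<inter> {0..1})"
    using B by (simp add: emeasure_restrict_space emeasure_completion)
  also have "\<dots> = emeasure (permuton_on {1..d} f g) A"
    unfolding permuton_on_def using A m by (simp add: emeasure_distr)
  finally show "emeasure (separable_permuton d f g) A = emeasure (permuton_on {1..d} f g) A" .
qed (simp add: separable_permuton_def permuton_on_def)

lemma marginal_permuton_on:
  assumes L: "countable (local_minima f)" and S: "S \<subseteq> T"
  shows "marginal S (permuton_on T f g) = permuton_on S f g"
proof -
  have "(\<lambda>x. restrict x S) \<in> measurable (cube T) (cube S)"
    unfolding cube_def by (rule measurable_restrict_subset[OF S])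
  then have "marginal S (permuton_on T f g) = distr unif (cube S)
      ((\<lambda>x. restrict x S) \<circ> (\<lambda>t. \<lambda>k\<in>T. if k = 1 then t else psi f (g (k - 1)) t))"
    unfolding marginal_def permuton_on_def
    by (rule distr_distr) (rule permuton_map_measurable[OF L])
  also have "\<dots> = permuton_on S f g"
    unfolding permuton_on_def using S by (intro distr_cong) (auto simp: fun_eq_iff restrict_def subset_eq)
  finally show ?thesis .
qed

lemma permuton_on_in_permutons:
  assumes L: "countable (local_minima f)" and N: "N \<in> null_sets lborel" "unique_minima_off f N"
  shows "permuton_on S f g \<in> permutons S"
proof -
  have "distr (permuton_on S f g) (restrict_space borel {0..1}) (\<lambda>x. x i) = unif" if i: "i \<in> S" for i
  proof -
    have "(\<lambda>x. x i) \<in> measurable (cube S) (restrict_space borel {0..1})"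
      unfolding cube_def by (rule measurable_component_singleton[OF i])
    then have "distr (permuton_on S f g) (restrict_space borel {0..1}) (\<lambda>x. x i) =
        distr unif (restrict_space borel {0..1})
          ((\<lambda>x. x i) \<circ> (\<lambda>t. \<lambda>k\<in>S. if k = 1 then t else psi f (g (k - 1)) t))"
      unfolding permuton_on_def by (rule distr_distr) (rule permuton_map_measurable[OF L])
    also have "\<dots> = distr unif (restrict_space borel {0..1}) (\<lambda>t. if i = 1 then t else psi f (g (i - 1)) t)"
      using i by (intro distr_cong) auto
    also have "\<dots> = unif"
    proof (cases "i = 1")
      case True
      have "distr unif (restrict_space borel {0..1}) (\<lambda>t. t) = distr unif unif (\<lambda>t. t)"
        by (rule distr_cong) (auto simp: sets_restrict_space)
      with True show ?thesis by (simp add: distr_id)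
    next
      case False
      then show ?thesis using psi_uniform[OF L N] by simp
    qed
    finally show ?thesis .
  qed
  moreover have "prob_space (permuton_on S f g)"
    unfolding permuton_on_def by (rule unif.prob_space_distr[OF permuton_map_measurable[OF L]])
  ultimately show ?thesis
    unfolding permutons_def by (simp add: permuton_on_def)
qed

lemma integral_permuton_on:
  assumes L: "countable (local_minima f)" and S: "1 \<in> S" "k \<in> S" "k \<noteq> 1"
  shows "(\<integral>x. x 1 * x k \<partial>permuton_on S f g) = (\<integral>t. t * psi f (g (k - 1)) t \<partial>unif)"
proof -
  have c: "(\<lambda>x. x i) \<in> borel_measurable (cube S)" if i: "i \<in> S" for i
  proof -
    have "(\<lambda>x. x i) \<in> measurable (cube S) (restrict_space borel {0..1})"
      unfolding cube_def by (rule measurable_component_singleton[OF i])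
    then show ?thesis by (simp add: measurable_restrict_space2_iff)
  qed
  have "(\<lambda>x. x 1 * x k) \<in> borel_measurable (cube S)"
    using c[OF S(1)] c[OF S(2)] by (rule borel_measurable_times)
  then have "(\<integral>x. x 1 * x k \<partial>permuton_on S f g) =
      (\<integral>t. (\<lambda>k\<in>S. if k = 1 then t else psi f (g (k - 1)) t) 1 * (\<lambda>k\<in>S. if k = 1 then t else psi f (g (k - 1)) t) k \<partial>unif)"
    unfolding permuton_on_def by (rule integral_distr[OF permuton_map_measurable[OF L]])
  also have "\<dots> = (\<integral>t. t * psi f (g (k - 1)) t \<partial>unif)"
    using S by simp
  finally show ?thesis .
qed

section \<open>The effect of a single sign\<close>

lemma psi_cong_signs:
  assumes "\<And>l. g l = 1 \<longleftrightarrow> g' l = 1"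
  shows "psi f g = psi f g'"
proof -
  have "positive_at_minimum f g x y \<longleftrightarrow> positive_at_minimum f g' x y" for x y
    using assms by (simp add: positive_at_minimum_def)
  then show ?thesis by (auto simp: psi_def excursion_less_def fun_eq_iff)
qed

text \<open>Changing the sign of \<open>l\<close> only affects pairs with one point in each wing: with a positive sign the
  left wing lies below every point of the right wing, with a negative sign the right wing lies below every
  point of the left wing.\<close>
lemma psi_flip:
  assumes L: "countable (local_minima f)" and l: "g l = 1" and t: "t \<in> {0..1}"
  shows "psi f g t - psi f (g(l := -1)) t =
    indicator (right_wing f l) t * measure unif (left_wing f l \<inter> {0..1})
     - indicator (left_wing f l) t * measure unif (right_wing f l \<inter> {0..1})"
proof -
  let ?g = "g(l := -1)"
  have meas: "{x\<in>space unif. excursion_less f h x t} \<in> sets unif" for h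
  proof (rule predE)
    have "t \<in> space unif" using t by simp
    from measurable_compose[OF measurable_Pair[OF measurable_ident measurable_const[OF this]]
        measurable_excursion_less[OF L, of h]]
    show "Measurable.pred unif (\<lambda>x. excursion_less f h x t)" by simp
  qed
  have i: "integrable unif (indicator {x\<in>space unif. excursion_less f h x t} :: real \<Rightarrow> real)" for h
    using meas[of h] by (simp add: unif.emeasure_eq_measure)
  have wings: "left_wing f l \<inter> {0..1} \<in> sets unif" "right_wing f l \<inter> {0..1} \<in> sets unif"
    by (auto simp: sets_restrict_space_iff)
  have p: "psi f h t = (\<integral>x. indicator {x\<in>space unif. excursion_less f h x t} x \<partial>unif)" for h
  proof -
    have "{x\<in>space unif. excursion_less f h x t} \<inter> space unif = {x\<in>space unif. excursion_less f h x t}"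
      by blast
    then show ?thesis by (simp only: psi_eq_rank[OF L t] Bochner_Integration.integral_indicator)
  qed
  have PM: "positive_at_minimum f g x y \<longleftrightarrow> positive_at_minimum f ?g x y \<or> (x \<in> left_wing f l \<and> y \<in> right_wing f l)"
    for x y
    unfolding positive_at_minimum_def using l interior_unique_minimum_iff[of l x y f]
    by (auto split: if_splits)
  have PMn: "\<not> positive_at_minimum f ?g x y" if "x \<in> left_wing f l" "y \<in> right_wing f l" for x y
    using that interior_unique_minimum_iff[of l x y f] unique_minimum_at_unique[of f x y l]
    unfolding positive_at_minimum_def by auto
  have LR: "z < l" if "z \<in> left_wing f l" for z using that by (simp add: left_wing_def)
  have RL: "l < z" if "z \<in> right_wing f l" for z using that by (simp add: right_wing_def)
  have pt: "indicator {x\<in>space unif. excursion_less f g x t} x - indicator {x\<in>space unif. excursion_less f ?g x t} x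
     = indicator (right_wing f l) t * indicator (left_wing f l \<inter> {0..1}) x -
       indicator (left_wing f l) t * (indicator (right_wing f l \<inter> {0..1}) x :: real)"
    if x: "x \<in> space unif" for x
  proof (cases x t rule: linorder_cases)
    case less
    then show ?thesis using x LR[of t] RL[of x] PM[of x t] PMn[of x t]
      by (auto simp: indicator_def excursion_less_def)
  next
    case equal
    then show ?thesis using LR[of x] RL[of x] by (auto simp: indicator_def excursion_less_def)
  next
    case greater
    then show ?thesis using x LR[of x] RL[of t] PM[of t x] PMn[of t x]
      by (auto simp: indicator_def excursion_less_def)
  qed
  have "psi f g t - psi f ?g t = (\<integral>x. indicator {x\<in>space unif. excursion_less f g x t} x
      - indicator {x\<in>space unif. excursion_less f ?g x t} x \<partial>unif)"
    unfolding p by (rule Bochner_Integration.integral_diff[symmetric]) (rule i)+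
  also have "\<dots> = (\<integral>x. indicator (right_wing f l) t * indicator (left_wing f l \<inter> {0..1}) x -
       indicator (left_wing f l) t * indicator (right_wing f l \<inter> {0..1}) x \<partial>unif)"
    by (rule Bochner_Integration.integral_cong[OF refl]) (rule pt)
  also have "\<dots> = (\<integral>x. indicator (right_wing f l) t * indicator (left_wing f l \<inter> {0..1}) x \<partial>unif) -
       (\<integral>x. indicator (left_wing f l) t * indicator (right_wing f l \<inter> {0..1}) x \<partial>unif)"
    using wings by (intro Bochner_Integration.integral_diff integrable_mult_right)
      (simp_all add: unif.emeasure_eq_measure)
  also have "\<dots> = indicator (right_wing f l) t * measure unif (left_wing f l \<inter> {0..1})
     - indicator (left_wing f l) t * measure unif (right_wing f l \<inter> {0..1})"
    using wings by (simp add: Int_absorb2 Int_assoc)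
  finally show ?thesis .
qed

text \<open>By \<open>psi_flip\<close>, the difference \<open>\<delta>\<close> of the two rank functions is positive on the right wing,
  negative on the left wing, zero elsewhere, and has integral 0. Hence the integral of \<open>t \<delta>(t)\<close> equals that of
  \<open>(t - l) \<delta>(t)\<close>, whose integrand is nonnegative. Strictness requires wings of positive measure: two
  points off the null set, one on each side of \<open>l\<close> and so close that \<open>l\<close> minimizes the path between
  them, have a unique minimum, which must be \<open>l\<close>.\<close>
lemma integral_flip:
  assumes L: "countable (local_minima f)" and N: "N \<in> null_sets lborel" "unique_minima_off f N"
    and lmin: "l \<in> local_minima f" and l: "g l = 1"
  shows "(\<integral>t. t * psi f (g(l := -1)) t \<partial>unif) < (\<integral>t. t * psi f g t \<partial>unif)"
proof -
  let ?I = "left_wing f l \<inter> {0..1}" and ?J = "right_wing f l \<inter> {0..1}"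
  let ?a = "measure unif ?I" and ?b = "measure unif ?J"
  have l01: "0 < l" "l < 1" and ev: "\<forall>\<^sub>F u in at l. f l \<le> f u"
    using lmin by (auto simp: local_minima_def)
  then obtain e where e: "e > 0" "\<And>u. dist u l < e \<Longrightarrow> f l \<le> f u"
    unfolding eventually_at by (metis UNIV_I order_refl)
  obtain x where x: "max 0 (l - e) < x" "x < l" "x \<notin> N"
  proof -
    have "\<not> {max 0 (l - e)<..<l} \<subseteq> N"
    proof
      assume "{max 0 (l - e)<..<l} \<subseteq> N"
      then have "{max 0 (l - e)<..<l} \<in> null_sets lborel"
        using N(1) by (auto intro: null_sets_subset)
      then show False using l01 e(1) by (auto simp: null_sets_def)
    qed
    then show thesis using that unfolding subset_iff greaterThanLessThan_iff by blast
  qed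
  obtain y where y: "l < y" "y < min 1 (l + e)" "y \<notin> N"
  proof -
    have "\<not> {l<..<min 1 (l + e)} \<subseteq> N"
    proof
      assume "{l<..<min 1 (l + e)} \<subseteq> N"
      then have "{l<..<min 1 (l + e)} \<in> null_sets lborel"
        using N(1) by (auto intro: null_sets_subset)
      then show False using l01 e(1) by (auto simp: null_sets_def)
    qed
    then show thesis using that unfolding subset_iff greaterThanLessThan_iff by blast
  qed
  obtain l' where l': "unique_minimum_at f x y l'"
    using N(2)[unfolded unique_minima_off_def, rule_format, of x y] x y l01 by auto
  have "l' = l"
  proof (rule ccontr)
    assume "l' \<noteq> l"
    then have "f l' < f l" using l' x y by (auto simp: unique_minimum_at_def)
    moreover have "f l \<le> f l'"
      using l' x y by (intro e(2)) (auto simp: unique_minimum_at_def dist_real_def)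
    ultimately show False by simp
  qed
  then have xy: "x \<in> left_wing f l" "y \<in> right_wing f l"
    using l' x y interior_unique_minimum_iff[of l x y f] by auto
  have sets: "?I \<in> sets unif" "?J \<in> sets unif"
    by (auto simp: sets_restrict_space_iff)
  have subs: "{x..<l} \<subseteq> ?I" "{l<..y} \<subseteq> ?J"
    using xy x y l01 by (auto simp: left_wing_def right_wing_def)
  have apos: "?a > 0"
  proof -
    have "0 < measure unif {x..<l}" using x l01 by (subst measure_restrict_space) auto
    also have "\<dots> \<le> ?a" using subs sets by (intro unif.finite_measure_mono)
    finally show ?thesis .
  qed
  have bpos: "?b > 0"
  proof -
    have "0 < measure unif {l<..y}" using y l01 by (subst measure_restrict_space) auto
    also have "\<dots> \<le> ?b" using subs sets by (intro unif.finite_measure_mono)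
    finally show ?thesis .
  qed
  have [measurable]: "(\<lambda>t. t) \<in> borel_measurable unif"
    by (intro measurable_restrict_space1) simp
  have ip: "integrable unif (\<lambda>t. t * psi f h t)" for h
  proof (rule unif.integrable_const_bound[where B=1])
    show "AE t in unif. norm (t * psi f h t) \<le> 1"
      using psi_in_unit[OF L, of _ h] by (intro AE_I2) (auto simp: abs_mult intro: mult_le_one)
    show "(\<lambda>t. t * psi f h t) \<in> borel_measurable unif"
      using measurable_psi[OF L, of h] by measurable
  qed
  have iI: "integrable unif (indicator ?I :: real \<Rightarrow> real)" "integrable unif (indicator ?J :: real \<Rightarrow> real)"
    using sets by (simp_all add: unif.emeasure_eq_measure)
  let ?d = "\<lambda>t. indicator ?J t * ?a - indicator ?I t * ?b"
  have d0: "(\<integral>t. ?d t \<partial>unif) = 0"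
    using iI sets by (simp add: Int_assoc)
  have id: "integrable unif ?d" using iI by (intro Bochner_Integration.integrable_diff) auto
  have dpsi: "psi f g t - psi f (g(l := -1)) t = ?d t" if "t \<in> space unif" for t
    using psi_flip[OF L, of g l t, OF l] that by (simp add: indicator_def)
  have itd: "integrable unif (\<lambda>t. t * ?d t)"
  proof -
    have "integrable unif (\<lambda>t. t * psi f g t - t * psi f (g(l := -1)) t)"
      by (intro Bochner_Integration.integrable_diff ip)
    then show ?thesis
      by (rule Bochner_Integration.integrable_cong[THEN iffD1, rotated 2])
         (use dpsi in \<open>auto simp: right_diff_distrib[symmetric]\<close>)
  qed
  have "(\<integral>t. t * psi f g t \<partial>unif) - (\<integral>t. t * psi f (g(l := -1)) t \<partial>unif) =
      (\<integral>t. t * psi f g t - t * psi f (g(l := -1)) t \<partial>unif)"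
    by (rule Bochner_Integration.integral_diff[symmetric]) (rule ip)+
  also have "\<dots> = (\<integral>t. t * ?d t \<partial>unif)"
    using dpsi by (intro Bochner_Integration.integral_cong) (auto simp: right_diff_distrib[symmetric])
  also have "\<dots> = (\<integral>t. t * ?d t \<partial>unif) - l * (\<integral>t. ?d t \<partial>unif)"
    using d0 by simp
  also have "\<dots> = (\<integral>t. t * ?d t - l * ?d t \<partial>unif)"
    using itd id by simp
  also have "\<dots> > 0"
  proof -
    have nn: "0 \<le> t * ?d t - l * ?d t" for t
      using apos bpos by (auto simp: indicator_def left_wing_def right_wing_def left_diff_distrib[symmetric]
         mult_le_0_iff zero_le_mult_iff)
    have int: "integrable unif (\<lambda>t. t * ?d t - l * ?d t)" using itd id by simp
    have "(\<integral>t. t * ?d t - l * ?d t \<partial>unif) \<noteq> 0"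
    proof
      assume "(\<integral>t. t * ?d t - l * ?d t \<partial>unif) = 0"
      then have "AE t in unif. t * ?d t - l * ?d t = 0"
        using integral_nonneg_eq_0_iff_AE[OF int] nn by simp
      then have "AE t in unif. t \<notin> ?J"
        by eventually_elim (use apos in \<open>auto simp: indicator_def left_wing_def right_wing_def\<close>)
      then have "?J \<in> null_sets unif" using sets by (simp add: AE_iff_null_sets)
      then show False using bpos by (simp add: measure_eq_0_null_sets)
    qed
    moreover have "0 \<le> (\<integral>t. t * ?d t - l * ?d t \<partial>unif)" using nn by (intro integral_nonneg_AE) simp
    ultimately show ?thesis by linarith
  qed
  finally show ?thesis by simp
qed

section \<open>Random permutons as random elements of the weak topology\<close>

text \<open>Points of the cube are rounded down to the grid of mesh \<open>1 / (n + 1)\<close>; cells are the sets of points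
  with the same rounding.\<close>
definition grid :: "nat \<Rightarrow> nat set \<Rightarrow> (nat \<Rightarrow> real) \<Rightarrow> nat \<Rightarrow> real" where
  "grid n S x = (\<lambda>i\<in>S. real (nat \<lfloor>real (Suc n) * x i\<rfloor>) / real (Suc n))"

definition cell :: "nat \<Rightarrow> nat set \<Rightarrow> (nat \<Rightarrow> nat) \<Rightarrow> (nat \<Rightarrow> real) set" where
  "cell n S c = {x \<in> PiE S (\<lambda>_. {0..1}). \<forall>i\<in>S. nat \<lfloor>real (Suc n) * x i\<rfloor> = c i}"

lemma space_cube: "space (cube S) = PiE S (\<lambda>_. {0..1})"
  by (simp add: cube_def space_PiM)

lemma floor_grid:
  assumes "0 \<le> x" "x \<le> 1"
  shows "nat \<lfloor>real (Suc n) * x\<rfloor> \<le> Suc n"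
    and "\<bar>real (nat \<lfloor>real (Suc n) * x\<rfloor>) / real (Suc n) - x\<bar> \<le> 1 / real (Suc n)"
proof -
  have "real (Suc n) * x \<le> real (Suc n)" using assms by (simp add: mult_left_le)
  then have "\<lfloor>real (Suc n) * x\<rfloor> \<le> int (Suc n)" by linarith
  then show "nat \<lfloor>real (Suc n) * x\<rfloor> \<le> Suc n" by linarith
  have "0 \<le> real (Suc n) * x" using assms by simp
  then have "\<bar>real (nat \<lfloor>real (Suc n) * x\<rfloor>) - real (Suc n) * x\<bar> \<le> 1" by linarith
  then have "\<bar>real (nat \<lfloor>real (Suc n) * x\<rfloor>) - real (Suc n) * x\<bar> / real (Suc n) \<le> 1 / real (Suc n)"
    by (intro divide_right_mono) auto
  also have "\<bar>real (nat \<lfloor>real (Suc n) * x\<rfloor>) - real (Suc n) * x\<bar> / real (Suc n) =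
      \<bar>(real (nat \<lfloor>real (Suc n) * x\<rfloor>) - real (Suc n) * x) / real (Suc n)\<bar>" by simp
  also have "(real (nat \<lfloor>real (Suc n) * x\<rfloor>) - real (Suc n) * x) / real (Suc n) =
      real (nat \<lfloor>real (Suc n) * x\<rfloor>) / real (Suc n) - x" by (simp add: field_simps)
  finally show "\<bar>real (nat \<lfloor>real (Suc n) * x\<rfloor>) / real (Suc n) - x\<bar> \<le> 1 / real (Suc n)" .
qed

lemma grid_in_cube:
  assumes "x \<in> PiE S (\<lambda>_. {0..1})"
  shows "grid n S x \<in> PiE S (\<lambda>_. {0..1})"
proof -
  have "real (nat \<lfloor>real (Suc n) * x i\<rfloor>) / real (Suc n) \<le> 1" if "i \<in> S" for i
  proof -
    have "x i \<in> {0..1}" using assms that by blast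
    then have "nat \<lfloor>real (Suc n) * x i\<rfloor> \<le> Suc n" by (intro floor_grid(1)) auto
    then have "real (nat \<lfloor>real (Suc n) * x i\<rfloor>) \<le> real (Suc n)" by (simp only: of_nat_le_iff)
    then show ?thesis by (subst divide_le_eq_1_pos) (simp_all del: of_nat_Suc)
  qed
  then show ?thesis by (simp add: grid_def PiE_iff del: of_nat_Suc)
qed

text \<open>This is uniform continuity on a compact space. To use sequential compactness, the cube is
  embedded in the metrizable space of all real sequences by filling the coordinates outside \<open>S\<close> with 0:
  a sequence of bad points has a convergent subsequence, and its roundings have the same limit.\<close>
lemma uniform_grid_approximation:
  assumes f: "continuous_map (cube_topology S) euclideanreal f" and e: "e > 0"
  shows "\<exists>n. \<forall>x\<in>PiE S (\<lambda>_. {0..1}). \<bar>f x - f (grid n S x)\<bar> < e"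
proof (rule ccontr)
  assume "\<not> ?thesis"
  then have "\<forall>n. \<exists>x\<in>PiE S (\<lambda>_. {0..1}). e \<le> \<bar>f x - f (grid n S x)\<bar>" by (auto simp: not_less)
  then obtain x where x: "\<And>n. x n \<in> PiE S (\<lambda>_. {0..1})" "\<And>n. e \<le> \<bar>f (x n) - f (grid n S (x n))\<bar>"
    by metis
  define Q where "Q = (PiE UNIV (\<lambda>_. {0..1}) :: (nat \<Rightarrow> real) set)"
  have Q: "compact Q"
  proof -
    have "compactin (product_topology (\<lambda>_. euclidean) UNIV) Q"
      unfolding Q_def by (subst compactin_PiE) (auto simp: compactin_euclidean_iff)
    then show ?thesis by (simp add: euclidean_product_topology)
  qed
  define F where "F y = f (restrict y S)" for y
  have F: "continuous_on Q F"
  proof -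
    have "continuous_map (top_of_set Q) (cube_topology S) (\<lambda>y. restrict y S)"
      unfolding cube_topology_def
    proof (subst continuous_map_componentwise, intro conjI ballI)
      show "(\<lambda>y. restrict y S) ` topspace (top_of_set Q) \<subseteq> extensional S" by auto
      fix k assume "k \<in> S"
      then show "continuous_map (top_of_set Q) (top_of_set {0..1}) (\<lambda>y. restrict y S k)"
        using continuous_on_subset[OF continuous_on_product_coordinates subset_UNIV[of Q], of k]
        by (auto simp: continuous_map_in_subtopology Q_def)
    qed
    from continuous_map_compose[OF this f] show ?thesis
      by (simp add: F_def[abs_def] o_def)
  qed
  define y where "y n = (\<lambda>i. if i \<in> S then x n i else 0)" for n
  define z where "z n = (\<lambda>i. if i \<in> S then grid n S (x n) i else 0)" for n
  have yQ: "y n \<in> Q" for n using x(1)[of n] by (auto simp: Q_def y_def PiE_iff)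
  have zQ: "z n \<in> Q" for n using grid_in_cube[OF x(1), of n n] by (auto simp: Q_def z_def PiE_iff)
  have "restrict (y n) S = x n" for n using x(1)[of n]
    by (auto simp: y_def fun_eq_iff restrict_def PiE_iff extensional_def)
  then have Fy: "F (y n) = f (x n)" for n by (simp add: F_def)
  have "restrict (z n) S = grid n S (x n)" for n
    by (auto simp: z_def grid_def fun_eq_iff)
  then have Fz: "F (z n) = f (grid n S (x n))" for n by (simp add: F_def)
  obtain l r where l: "l \<in> Q" and r: "strict_mono r" and lim: "(y \<circ> r) \<longlonglongrightarrow> l"
    using Q yQ unfolding compact_def by metis
  have limi: "(\<lambda>n. y (r n) i) \<longlonglongrightarrow> l i" for i
    using lim unfolding limitin_canonical_iff[symmetric] euclidean_product_topology[symmetric]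
    by (simp add: limitin_componentwise o_def)
  have "(\<lambda>n. z (r n) i) \<longlonglongrightarrow> l i" for i
  proof -
    have "(\<lambda>n. 1 / real (Suc n)) \<longlonglongrightarrow> 0" using LIMSEQ_inverse_real_of_nat by (simp add: inverse_eq_divide)
    from LIMSEQ_subseq_LIMSEQ[OF this r] have inv: "(\<lambda>n. 1 / real (Suc (r n))) \<longlonglongrightarrow> 0" by (simp add: o_def)
    have "(\<lambda>n. z (r n) i - y (r n) i) \<longlonglongrightarrow> 0"
    proof (rule Lim_null_comparison[OF _ inv], intro always_eventually allI)
      fix n
      show "norm (z (r n) i - y (r n) i) \<le> 1 / real (Suc (r n))"
      proof (cases "i \<in> S")
        case True
        then have "x (r n) i \<in> {0..1}" using x(1)[of "r n"] by blast
        then show ?thesis using True floor_grid(2)[of "x (r n) i" "r n"]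
          by (simp add: z_def y_def grid_def del: of_nat_Suc)
      qed (simp add: z_def y_def)
    qed
    from tendsto_add[OF this limi[of i]] show ?thesis by simp
  qed
  then have limz: "(z \<circ> r) \<longlonglongrightarrow> l"
    unfolding limitin_canonical_iff[symmetric] euclidean_product_topology[symmetric]
    by (simp add: limitin_componentwise o_def)
  have "(\<lambda>n. F ((y \<circ> r) n)) \<longlonglongrightarrow> F l" "(\<lambda>n. F ((z \<circ> r) n)) \<longlonglongrightarrow> F l"
    by (rule continuous_on_tendsto_compose[OF F lim l] continuous_on_tendsto_compose[OF F limz l]; simp add: yQ zQ)+
  from tendsto_diff[OF this] have "(\<lambda>n. \<bar>F (y (r n)) - F (z (r n))\<bar>) \<longlonglongrightarrow> 0"
    by (simp add: tendsto_rabs_zero)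
  then have "\<forall>\<^sub>F n in sequentially. \<bar>F (y (r n)) - F (z (r n))\<bar> < e"
    using e by (rule order_tendstoD)
  then obtain n where "\<bar>F (y (r n)) - F (z (r n))\<bar> < e"
    by (auto simp: eventually_sequentially)
  then show False using x(2)[of "r n"] by (simp add: Fy Fz)
qed

lemma cell_in_sets:
  assumes "finite S"
  shows "cell n S c \<in> sets (cube S)"
proof -
  have [measurable]: "(\<lambda>x. x i) \<in> borel_measurable (cube S)" if i: "i \<in> S" for i
  proof -
    have "(\<lambda>x. x i) \<in> measurable (cube S) (restrict_space borel {0..1})"
      unfolding cube_def by (rule measurable_component_singleton[OF i])
    then show ?thesis by (simp add: measurable_restrict_space2_iff)
  qed
  have "{x \<in> space (cube S). \<forall>i\<in>S. nat \<lfloor>real (Suc n) * x i\<rfloor> = c i} \<in> sets (cube S)"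
    using countable_finite[OF assms] by measurable
  then show ?thesis by (simp add: cell_def space_cube)
qed

lemma grid_function_eq_sum:
  assumes S: "finite S" and x: "x \<in> PiE S (\<lambda>_. {0..1})"
  shows "f (grid n S x) =
    (\<Sum>c\<in>PiE S (\<lambda>_. {..Suc n}). f (\<lambda>i\<in>S. real (c i) / real (Suc n)) * indicator (cell n S c) x :: real)"
proof -
  define c where "c = (\<lambda>i\<in>S. nat \<lfloor>real (Suc n) * x i\<rfloor>)"
  have c: "c \<in> PiE S (\<lambda>_. {..Suc n})"
    using x floor_grid(1) by (auto simp: c_def PiE_iff simp del: of_nat_Suc)
  have "indicator (cell n S b) x = (if b = c then 1 else 0 :: real)" if "b \<in> PiE S (\<lambda>_. {..Suc n})" for b
  proof -
    have "x \<in> cell n S b \<longleftrightarrow> b = c"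
      using x that by (auto simp: cell_def c_def fun_eq_iff PiE_iff extensional_def)
    then show ?thesis by (simp add: indicator_def)
  qed
  then have "(\<Sum>c\<in>PiE S (\<lambda>_. {..Suc n}). f (\<lambda>i\<in>S. real (c i) / real (Suc n)) * indicator (cell n S c) x) =
      (\<Sum>b\<in>PiE S (\<lambda>_. {..Suc n}). if b = c then f (\<lambda>i\<in>S. real (b i) / real (Suc n)) else 0)"
    by (intro sum.cong) auto
  also have "\<dots> = f (\<lambda>i\<in>S. real (c i) / real (Suc n))"
    using c S by (simp add: finite_PiE)
  also have "(\<lambda>i\<in>S. real (c i) / real (Suc n)) = grid n S x"
    by (auto simp: grid_def c_def)
  finally show ?thesis by (rule sym)
qed

text \<open>The sum is the integral of \<open>f\<close> after rounding. The measurability of \<open>f\<close> for the product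
  \<sigma>-algebra comes from the same rounding, as \<open>f\<close> is a limit of the rounded functions.\<close>
lemma grid_integral:
  assumes S: "finite S" and mu: "\<mu> \<in> permutons S"
    and f: "continuous_map (cube_topology S) euclideanreal f"
    and n: "\<And>x. x \<in> PiE S (\<lambda>_. {0..1}) \<Longrightarrow> \<bar>f x - f (grid n S x)\<bar> < e"
  shows "\<bar>(\<integral>x. f x \<partial>\<mu>) -
    (\<Sum>c\<in>PiE S (\<lambda>_. {..Suc n}). f (\<lambda>i\<in>S. real (c i) / real (Suc n)) * measure \<mu> (cell n S c))\<bar> \<le> e"
proof -
  interpret prob_space \<mu> using mu by (simp add: permutons_def)
  have sets [measurable_cong]: "sets \<mu> = sets (cube S)" using mu by (simp add: permutons_def)
  have space: "space \<mu> = PiE S (\<lambda>_. {0..1})" using sets_eq_imp_space_eq[OF sets] space_cube by simp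
  have cm [measurable]: "cell m S c \<in> sets \<mu>" for m c using cell_in_sets[OF S] sets by simp
  let ?s = "\<lambda>m x. \<Sum>c\<in>PiE S (\<lambda>_. {..Suc m}). f (\<lambda>i\<in>S. real (c i) / real (Suc m)) * indicator (cell m S c) x"
  have sm: "integrable \<mu> (?s m)" for m
    by (intro Bochner_Integration.integrable_sum integrable_mult_right)
       (simp add: emeasure_eq_measure)
  have eq: "f (grid m S x) = ?s m x" if "x \<in> space \<mu>" for m x
    using grid_function_eq_sum[OF S] that space by blast
  have gm: "(\<lambda>x. f (grid m S x)) \<in> borel_measurable \<mu>" for m
    using borel_measurable_integrable[OF sm[of m]] by (subst measurable_cong[OF eq])
  have fm [measurable]: "f \<in> borel_measurable \<mu>"
  proof -
    have "\<exists>m. \<forall>x\<in>space \<mu>. \<bar>f x - f (grid m S x)\<bar> < 1 / real (Suc k)" for k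
      using uniform_grid_approximation[OF f, of "1 / real (Suc k)"] space by simp
    then obtain m where m: "\<And>k x. x \<in> space \<mu> \<Longrightarrow> \<bar>f x - f (grid (m k) S x)\<bar> < 1 / real (Suc k)"
      by metis
    show ?thesis
    proof (rule borel_measurable_LIMSEQ_real)
      show "(\<lambda>x. f (grid (m k) S x)) \<in> borel_measurable \<mu>" for k by (rule gm)
      fix x assume x: "x \<in> space \<mu>"
      have inv: "(\<lambda>n. 1 / real (Suc n)) \<longlonglongrightarrow> 0" using LIMSEQ_inverse_real_of_nat by (simp add: inverse_eq_divide)
      have "(\<lambda>k. f (grid (m k) S x) - f x) \<longlonglongrightarrow> 0"
        by (rule Lim_null_comparison[OF _ inv], intro always_eventually allI)
           (use m[OF x] in \<open>auto simp: abs_minus_commute less_imp_le simp del: of_nat_Suc\<close>)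
      from tendsto_add[OF this tendsto_const[of "f x"]] show "(\<lambda>k. f (grid (m k) S x)) \<longlonglongrightarrow> f x" by simp
    qed
  qed
  have close: "\<bar>f x - ?s n x\<bar> \<le> e" if "x \<in> space \<mu>" for x
  proof -
    have "\<bar>f x - f (grid n S x)\<bar> \<le> e"
      using n[of x] that unfolding space by (intro less_imp_le)
    then show ?thesis by (subst eq[OF that, symmetric])
  qed
  have diff: "integrable \<mu> (\<lambda>x. f x - ?s n x)"
  proof (rule integrable_const_bound[where B=e])
    show "AE x in \<mu>. norm (f x - ?s n x) \<le> e"
      by (rule AE_I2) (simp only: real_norm_def close)
    show "(\<lambda>x. f x - ?s n x) \<in> borel_measurable \<mu>"
      using fm borel_measurable_integrable[OF sm[of n]] by (rule borel_measurable_diff)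
  qed
  have fi: "integrable \<mu> f"
    using Bochner_Integration.integrable_add[OF diff sm[of n]] by simp
  have "(\<integral>x. ?s n x \<partial>\<mu>) = (\<Sum>c\<in>PiE S (\<lambda>_. {..Suc n}). f (\<lambda>i\<in>S. real (c i) / real (Suc n)) * measure \<mu> (cell n S c))"
    by (subst Bochner_Integration.integral_sum)
       (auto simp: emeasure_eq_measure intro!: integrable_mult_right sum.cong)
  then have "\<bar>(\<integral>x. f x \<partial>\<mu>) -
    (\<Sum>c\<in>PiE S (\<lambda>_. {..Suc n}). f (\<lambda>i\<in>S. real (c i) / real (Suc n)) * measure \<mu> (cell n S c))\<bar>
    = \<bar>\<integral>x. f x - ?s n x \<partial>\<mu>\<bar>"
    using Bochner_Integration.integral_diff[OF fi sm[of n]] by simp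
  also have "\<dots> \<le> (\<integral>x. \<bar>f x - ?s n x\<bar> \<partial>\<mu>)"
    using integral_norm_bound[of \<mu> "\<lambda>x. f x - ?s n x"] by simp
  also have "\<dots> \<le> (\<integral>x. e \<partial>\<mu>)"
    by (rule integral_mono[OF integrable_abs[OF diff] _ close]) simp
  also have "\<dots> = e" by (simp add: prob_space)
  finally show ?thesis .
qed

lemma topspace_weak_topology: "topspace (weak_topology S) = permutons S"
proof -
  let ?B = "{{\<mu> \<in> permutons S. (\<integral>x. f x \<partial>\<mu>) \<in> U} | f U.
      continuous_map (cube_topology S) euclideanreal f \<and> open U}"
  have "permutons S \<in> ?B"
    by (intro CollectI exI[of _ "\<lambda>_. 0"] exI[of _ UNIV]) auto
  moreover have "b \<subseteq> permutons S" if "b \<in> ?B" for b using that by auto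
  ultimately have "\<Union>?B = permutons S" by (intro subset_antisym Union_least Union_upper)
  then show ?thesis unfolding weak_topology_def topology_generated_by_topspace .
qed

text \<open>The cells of all grids are listed in one sequence because the space of real sequences is second
  countable: its Borel sets are detected by single coordinates.\<close>
definition cell_index :: "nat set \<Rightarrow> (nat \<times> (nat \<Rightarrow> nat)) set" where
  "cell_index S = (SIGMA n:UNIV. PiE S (\<lambda>_. {..Suc n}))"

definition cell_masses :: "nat set \<Rightarrow> (nat \<Rightarrow> real) measure \<Rightarrow> nat \<Rightarrow> real" where
  "cell_masses S \<mu> k = (case from_nat_into (cell_index S) k of (n, c) \<Rightarrow> measure \<mu> (cell n S c))"

lemma countable_cell_index: "finite S \<Longrightarrow> countable (cell_index S)"
  unfolding cell_index_def by (intro countable_SIGMA) (auto intro!: countable_finite finite_PiE)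

lemma cell_masses_index:
  assumes "finite S" "c \<in> PiE S (\<lambda>_. {..Suc n})"
  shows "cell_masses S \<mu> (to_nat_on (cell_index S) (n, c)) = measure \<mu> (cell n S c)"
proof -
  have "(n, c) \<in> cell_index S" using assms by (simp add: cell_index_def)
  then have "from_nat_into (cell_index S) (to_nat_on (cell_index S) (n, c)) = (n, c)"
    using countable_cell_index[OF assms(1)] by (simp add: from_nat_into_to_nat_on)
  then show ?thesis by (simp add: cell_masses_def)
qed

text \<open>For a subbasic open set, given by the integral of a continuous function \<open>f\<close>, the integral
  is within \<open>e / 3\<close> of a finite linear combination of cell masses, uniformly over all permutons. Thus
  the condition on the integral is locally implied by an open condition on finitely many masses.\<close>
lemma weak_open_cell_masses:
  assumes S: "finite S" and U: "openin (weak_topology S) U"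
  shows "\<exists>W. open W \<and> (\<forall>\<mu>\<in>permutons S. \<mu> \<in> U \<longleftrightarrow> cell_masses S \<mu> \<in> W)"
proof -
  have "generate_topology_on {{\<mu> \<in> permutons S. (\<integral>x. f x \<partial>\<mu>) \<in> U} | f U.
      continuous_map (cube_topology S) euclideanreal f \<and> open U} U"
    using U unfolding weak_topology_def openin_topology_generated_by_iff .
  then have "\<forall>\<nu>\<in>permutons S \<inter> U. \<exists>W. open W \<and> cell_masses S \<nu> \<in> W \<and>
      (\<forall>\<mu>\<in>permutons S. cell_masses S \<mu> \<in> W \<longrightarrow> \<mu> \<in> U)"
  proof induction
    case Empty
    then show ?case by simp
  next
    case (Int a b)
    show ?case
    proof
      fix \<nu> assume \<nu>: "\<nu> \<in> permutons S \<inter> (a \<inter> b)"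
      obtain V where V: "open V" "cell_masses S \<nu> \<in> V" "\<And>\<mu>. \<mu>\<in>permutons S \<Longrightarrow> cell_masses S \<mu> \<in> V \<Longrightarrow> \<mu> \<in> a"
        using bspec[OF Int.IH(1), of \<nu>] \<nu> by auto
      obtain W where W: "open W" "cell_masses S \<nu> \<in> W" "\<And>\<mu>. \<mu>\<in>permutons S \<Longrightarrow> cell_masses S \<mu> \<in> W \<Longrightarrow> \<mu> \<in> b"
        using bspec[OF Int.IH(2), of \<nu>] \<nu> by auto
      show "\<exists>W. open W \<and> cell_masses S \<nu> \<in> W \<and>
        (\<forall>\<mu>\<in>permutons S. cell_masses S \<mu> \<in> W \<longrightarrow> \<mu> \<in> a \<inter> b)"
        using V W by (intro exI[of _ "V \<inter> W"]) auto
    qed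
  next
    case (UN K)
    show ?case
    proof
      fix \<nu> assume \<nu>: "\<nu> \<in> permutons S \<inter> \<Union>K"
      then obtain k where k: "k \<in> K" "\<nu> \<in> permutons S \<inter> k" by blast
      obtain W where W: "open W" "cell_masses S \<nu> \<in> W" "\<And>\<mu>. \<mu>\<in>permutons S \<Longrightarrow> cell_masses S \<mu> \<in> W \<Longrightarrow> \<mu> \<in> k"
        using bspec[OF UN.IH[OF k(1)] k(2)] by auto
      show "\<exists>W. open W \<and> cell_masses S \<nu> \<in> W \<and>
        (\<forall>\<mu>\<in>permutons S. cell_masses S \<mu> \<in> W \<longrightarrow> \<mu> \<in> \<Union>K)"
        using W k(1) by (intro exI[of _ W]) auto
    qed
  next
    case (Basis s)
    then obtain f V where s: "s = {\<mu> \<in> permutons S. (\<integral>x. f x \<partial>\<mu>) \<in> V}"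
      and f: "continuous_map (cube_topology S) euclideanreal f" and V: "open V" by blast
    show ?case
    proof
      fix \<nu> assume "\<nu> \<in> permutons S \<inter> s"
      then have \<nu>: "\<nu> \<in> permutons S" "(\<integral>x. f x \<partial>\<nu>) \<in> V" using s by auto
      obtain e where e: "e > 0" "ball (\<integral>x. f x \<partial>\<nu>) e \<subseteq> V"
        using V \<nu>(2) open_contains_ball by blast
      obtain n where n: "\<And>x. x \<in> PiE S (\<lambda>_. {0..1}) \<Longrightarrow> \<bar>f x - f (grid n S x)\<bar> < e / 3"
        using uniform_grid_approximation[OF f, of "e / 3"] e(1) by auto
      define \<Phi> where "\<Phi> w = (\<Sum>c\<in>PiE S (\<lambda>_. {..Suc n}).
        f (\<lambda>i\<in>S. real (c i) / real (Suc n)) * w (to_nat_on (cell_index S) (n, c)))" for w :: "nat \<Rightarrow> real"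
      have \<Phi>: "\<bar>(\<integral>x. f x \<partial>\<mu>) - \<Phi> (cell_masses S \<mu>)\<bar> \<le> e / 3" if "\<mu> \<in> permutons S" for \<mu>
      proof -
        have "\<Phi> (cell_masses S \<mu>) = (\<Sum>c\<in>PiE S (\<lambda>_. {..Suc n}).
            f (\<lambda>i\<in>S. real (c i) / real (Suc n)) * measure \<mu> (cell n S c))"
          unfolding \<Phi>_def by (intro sum.cong refl) (simp only: cell_masses_index[OF S])
        then show ?thesis using grid_integral[OF S that f n] by (simp only:)
      qed
      let ?W = "\<Phi> -` ball (\<Phi> (cell_masses S \<nu>)) (e / 3)"
      have "continuous_on UNIV \<Phi>"
        unfolding \<Phi>_def by (intro continuous_intros continuous_on_product_coordinates)
      then have "open ?W" by (intro open_vimage) auto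
      moreover have "cell_masses S \<nu> \<in> ?W" using e by simp
      moreover have "\<mu> \<in> s" if \<mu>: "\<mu> \<in> permutons S" "cell_masses S \<mu> \<in> ?W" for \<mu>
      proof -
        have "\<bar>\<Phi> (cell_masses S \<nu>) - \<Phi> (cell_masses S \<mu>)\<bar> < e / 3"
          using \<mu>(2) by (simp add: dist_real_def)
        then have "\<bar>(\<integral>x. f x \<partial>\<nu>) - (\<integral>x. f x \<partial>\<mu>)\<bar> < e"
          using \<Phi>[OF \<mu>(1)] \<Phi>[OF \<nu>(1)] by linarith
        then have "(\<integral>x. f x \<partial>\<mu>) \<in> V" using e(2) by (auto simp: dist_real_def)
        then show ?thesis using \<mu>(1) s by simp
      qed
      ultimately show "\<exists>W. open W \<and> cell_masses S \<nu> \<in> W \<and>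
        (\<forall>\<mu>\<in>permutons S. cell_masses S \<mu> \<in> W \<longrightarrow> \<mu> \<in> s)" by blast
    qed
  qed
  then obtain W where W: "\<And>\<nu>. \<nu> \<in> permutons S \<inter> U \<Longrightarrow> open (W \<nu>) \<and> cell_masses S \<nu> \<in> W \<nu> \<and>
      (\<forall>\<mu>\<in>permutons S. cell_masses S \<mu> \<in> W \<nu> \<longrightarrow> \<mu> \<in> U)" by metis
  show ?thesis
    using W by (intro exI[of _ "\<Union>\<nu>\<in>permutons S \<inter> U. W \<nu>"]) blast
qed

lemma measurable_weak_topologyI:
  assumes S: "finite S" and h: "\<And>\<omega>. \<omega> \<in> space K \<Longrightarrow> h \<omega> \<in> permutons S"
    and cells: "\<And>n c. (\<lambda>\<omega>. measure (h \<omega>) (cell n S c)) \<in> borel_measurable K"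
  shows "h \<in> K \<rightarrow>\<^sub>M borel_of (weak_topology S)"
  unfolding borel_of_def
proof (rule measurable_measure_of)
  show "{U. openin (weak_topology S) U} \<subseteq> Pow (topspace (weak_topology S))"
    using openin_subset by blast
  show "h \<in> space K \<rightarrow> topspace (weak_topology S)"
    using h by (simp add: topspace_weak_topology)
  fix U assume "U \<in> {U. openin (weak_topology S) U}"
  then obtain W where W: "open W" "\<And>\<mu>. \<mu>\<in>permutons S \<Longrightarrow> \<mu> \<in> U \<longleftrightarrow> cell_masses S \<mu> \<in> W"
    using weak_open_cell_masses[OF S, of U] by auto
  have "(\<lambda>\<omega>. cell_masses S (h \<omega>)) \<in> borel_measurable K"
  proof (rule measurable_coordinatewise_then_product)
    fix k
    show "(\<lambda>\<omega>. cell_masses S (h \<omega>) k) \<in> borel_measurable K"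
      by (cases "from_nat_into (cell_index S) k") (simp add: cell_masses_def cells)
  qed
  then have "(\<lambda>\<omega>. cell_masses S (h \<omega>)) -` W \<inter> space K \<in> sets K"
    using W(1) by (intro measurable_sets[of _ K borel]) auto
  also have "(\<lambda>\<omega>. cell_masses S (h \<omega>)) -` W \<inter> space K = h -` U \<inter> space K"
    using W(2) h by auto
  finally show "h -` U \<inter> space K \<in> sets K" .
qed

lemma measurable_weak_integral:
  assumes f: "continuous_map (cube_topology S) euclideanreal f"
  shows "(\<lambda>\<mu>. \<integral>x. f x \<partial>\<mu>) \<in> borel_measurable (borel_of (weak_topology S))"
proof (rule borel_measurableI)
  fix V :: "real set" assume V: "open V"
  have space: "space (borel_of (weak_topology S)) = permutons S"
    unfolding borel_of_def by (simp add: space_measure_of_conv topspace_weak_topology)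
  have "openin (weak_topology S) {\<mu> \<in> permutons S. (\<integral>x. f x \<partial>\<mu>) \<in> V}"
    unfolding weak_topology_def using f V by (intro topology_generated_by_Basis) auto
  then have "{\<mu> \<in> permutons S. (\<integral>x. f x \<partial>\<mu>) \<in> V} \<in> sets (borel_of (weak_topology S))"
    unfolding borel_of_def using openin_subset by (subst sets_measure_of) (auto intro!: sigma_sets.Basic)
  also have "{\<mu> \<in> permutons S. (\<integral>x. f x \<partial>\<mu>) \<in> V} =
      (\<lambda>\<mu>. \<integral>x. f x \<partial>\<mu>) -` V \<inter> space (borel_of (weak_topology S))"
    using space by auto
  finally show "(\<lambda>\<mu>. \<integral>x. f x \<partial>\<mu>) -` V \<inter> space (borel_of (weak_topology S)) \<in> sets (borel_of (weak_topology S))" .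
qed

section \<open>Joint measurability in the path and the position\<close>

text \<open>To be above \<open>f l\<close> on \<open>[x, y]\<close> except at \<open>l\<close> means, by compactness, to exceed \<open>f l\<close> by a positive
  amount away from each neighbourhood of \<open>l\<close>. In this form rational points suffice and only countably
  many quantifiers remain.\<close>
lemma wings_iff_rational:
  assumes f: "continuous_on {0..1} f" and xy: "0 \<le> x" "y \<le> 1"
  shows "x \<in> left_wing f l \<and> y \<in> right_wing f l \<longleftrightarrow> x < l \<and> l < y \<and>
    (\<forall>m. \<exists>k. \<forall>q::rat. x \<le> of_rat q \<and> of_rat q \<le> y \<and> 1 / real (Suc m) \<le> \<bar>of_rat q - l\<bar> \<longrightarrow>
      f l + 1 / real (Suc k) \<le> f (of_rat q))" (is "?W \<longleftrightarrow> x < l \<and> l < y \<and> ?R")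
proof -
  have W: "?W \<longleftrightarrow> x < l \<and> l < y \<and> (\<forall>u\<in>{x..y}. u \<noteq> l \<longrightarrow> f l < f u)"
    using interior_unique_minimum_iff[of l x y f] by (auto simp: unique_minimum_at_def)
  have "(\<forall>u\<in>{x..y}. u \<noteq> l \<longrightarrow> f l < f u) \<longleftrightarrow> ?R" if l: "x < l" "l < y"
  proof
    assume *: "\<forall>u\<in>{x..y}. u \<noteq> l \<longrightarrow> f l < f u"
    show ?R
    proof
      fix m
      define T where "T = {x..y} - {l - 1 / real (Suc m)<..<l + 1 / real (Suc m)}"
      have T: "compact T" unfolding T_def by (intro compact_diff) auto
      have fT: "continuous_on T f"
        by (rule continuous_on_subset[OF f]) (use xy in \<open>auto simp: T_def\<close>)
      have memT: "of_rat q \<in> T" if "x \<le> of_rat q \<and> of_rat q \<le> y \<and> 1 / real (Suc m) \<le> \<bar>of_rat q - l\<bar>" for q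
      proof -
        have "of_rat q \<notin> {l - 1 / real (Suc m)<..<l + 1 / real (Suc m)}"
          using that unfolding greaterThanLessThan_iff by linarith
        then show ?thesis using that by (simp add: T_def del: of_nat_Suc)
      qed
      show "\<exists>k. \<forall>q::rat. x \<le> of_rat q \<and> of_rat q \<le> y \<and> 1 / real (Suc m) \<le> \<bar>of_rat q - l\<bar> \<longrightarrow>
        f l + 1 / real (Suc k) \<le> f (of_rat q)"
      proof (cases "T = {}")
        case True
        then show ?thesis using memT by blast
      next
        case False
        obtain v where v: "v \<in> T" "\<And>u. u \<in> T \<Longrightarrow> f v \<le> f u"
          using continuous_attains_inf[OF T False fT] by blast
        have "l \<notin> T" by (simp add: T_def)
        then have "v \<noteq> l" "v \<in> {x..y}" using v(1) by (metis, simp add: T_def)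
        then have "f l < f v" using * by blast
        then obtain k where "inverse (real (Suc k)) < f v - f l"
          using reals_Archimedean[of "f v - f l"] by auto
        then have k: "f l + 1 / real (Suc k) \<le> f v" by (simp add: inverse_eq_divide del: of_nat_Suc)
        show ?thesis
          by (intro exI[of _ k] allI impI order_trans[OF k] v(2) memT)
      qed
    qed
  next
    assume R: ?R
    show "\<forall>u\<in>{x..y}. u \<noteq> l \<longrightarrow> f l < f u"
    proof (intro ballI impI)
      fix u assume u: "u \<in> {x..y}" "u \<noteq> l"
      then obtain m where m: "inverse (real (Suc m)) < \<bar>u - l\<bar>"
        using reals_Archimedean[of "\<bar>u - l\<bar>"] by auto
      obtain k where k: "\<And>q::rat. x \<le> of_rat q \<Longrightarrow> of_rat q \<le> y \<Longrightarrow> 1 / real (Suc m) \<le> \<bar>of_rat q - l\<bar> \<Longrightarrow>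
          f l + 1 / real (Suc k) \<le> f (of_rat q)"
        using R by blast
      have "f l + 1 / real (Suc k) \<le> f u"
      proof (rule ccontr)
        assume "\<not> ?thesis"
        then have pos: "f l + 1 / real (Suc k) - f u > 0" by simp
        have "u \<in> {0..1}" using u xy by auto
        then obtain \<delta> where \<delta>: "\<delta> > 0"
          "\<And>v. v \<in> {0..1} \<Longrightarrow> dist v u < \<delta> \<Longrightarrow> dist (f v) (f u) < f l + 1 / real (Suc k) - f u"
          using f[unfolded continuous_on_iff, rule_format, OF _ pos] by blast
        define \<eta> where "\<eta> = min \<delta> (\<bar>u - l\<bar> - inverse (real (Suc m)))"
        have \<eta>: "\<eta> > 0" "\<eta> \<le> \<delta>" "\<eta> \<le> \<bar>u - l\<bar> - inverse (real (Suc m))"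
          using \<delta>(1) m by (auto simp: \<eta>_def)
        \<comment> \<open>\<open>\<eta>\<close> keeps rational points near \<open>u\<close> outside the neighbourhood of \<open>l\<close>.\<close>
        have "max x (u - \<eta>) < min y (u + \<eta>)"
          using u l \<eta>(1) by auto
        then obtain q where q: "max x (u - \<eta>) < of_rat q" "of_rat q < min y (u + \<eta>)"
          using of_rat_dense by blast
        then have d: "\<bar>of_rat q - u\<bar> < \<eta>" by auto
        have "f l + 1 / real (Suc k) \<le> f (of_rat q)"
          using q d \<eta>(3) by (intro k) (auto simp: inverse_eq_divide simp del: of_nat_Suc)
        moreover have "dist (f (of_rat q)) (f u) < f l + 1 / real (Suc k) - f u"
        proof (rule \<delta>(2))
          show "of_rat q \<in> {0..1::real}" using q xy unfolding atLeastAtMost_iff by linarith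
          show "dist (of_rat q) u < \<delta>" using d \<eta>(2) by (simp add: dist_real_def)
        qed
        ultimately show False unfolding dist_real_def by linarith
      qed
      moreover have "0 < 1 / real (Suc k)" by simp
      ultimately show "f l < f u" by linarith
    qed
  qed
  then show ?thesis using W by blast
qed

text \<open>A continuous random path with a measurable enumeration of its local minima. The \<sigma>-algebra is a
  parameter, so that it can be one which leaves out part of the randomness.\<close>
locale measurable_labelled_minima =
  fixes K :: "'w measure" and E :: "'w \<Rightarrow> real \<Rightarrow> real" and L :: "nat \<Rightarrow> 'w \<Rightarrow> real"
  assumes continuous_path: "\<And>\<omega>. \<omega> \<in> space K \<Longrightarrow> continuous_on {0..1} (E \<omega>)"
    and measurable_path: "\<And>t. t \<in> {0..1} \<Longrightarrow> (\<lambda>\<omega>. E \<omega> t) \<in> borel_measurable K"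
    and measurable_position: "\<And>n. L n \<in> borel_measurable K"
    and range_position: "\<And>\<omega>. \<omega> \<in> space K \<Longrightarrow> range (\<lambda>n. L n \<omega>) = local_minima (E \<omega>)"
begin

lemma countable_minima: "\<omega> \<in> space K \<Longrightarrow> countable (local_minima (E \<omega>))"
  by (metis range_position countable_image countableI_type)

text \<open>Paths are only known to be measurable at times in \<open>[0, 1]\<close>; the value 0 elsewhere gives a
  function that can be used at all rationals.\<close>
definition clipped :: "real \<Rightarrow> 'w \<Rightarrow> real" where
  "clipped t \<omega> = (if t \<in> {0..1} then E \<omega> t else 0)"

lemma measurable_clipped: "clipped t \<in> borel_measurable K"
proof (cases "t \<in> {0..1}")
  case True
  then show ?thesis unfolding clipped_def[abs_def] using measurable_path by (simp only: if_True)
next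
  case False
  then show ?thesis unfolding clipped_def[abs_def] by (simp only: if_False measurable_const UNIV_I space_borel)
qed

text \<open>The path is read at a random time, which is rounded to a grid and then refined, by continuity.\<close>
lemma measurable_minimum: "(\<lambda>\<omega>. E \<omega> (L n \<omega>)) \<in> borel_measurable K"
proof (rule borel_measurable_LIMSEQ_real)
  let ?g = "\<lambda>m \<omega>. \<lfloor>real (Suc m) * L n \<omega>\<rfloor>"
  let ?E = "\<lambda>m (i::int) \<omega>. clipped (real_of_int i / real (Suc m)) \<omega>"
  show "(\<lambda>\<omega>. ?E m (?g m \<omega>) \<omega>) \<in> borel_measurable K" for m
  proof (rule measurable_compose_countable[where f="?E m" and g="?g m"])
    show "?E m i \<in> borel_measurable K" for i
      by (rule measurable_clipped)
    show "?g m \<in> measurable K (count_space UNIV)"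
      using measurable_position[of n] by measurable
  qed
  fix \<omega> assume \<omega>: "\<omega> \<in> space K"
  have l: "0 < L n \<omega>" "L n \<omega> < 1"
    using range_position[OF \<omega>] by (auto simp: local_minima_def)
  have g: "real_of_int (?g m \<omega>) / real (Suc m) \<in> {0..1}"
    and d: "\<bar>real_of_int (?g m \<omega>) / real (Suc m) - L n \<omega>\<bar> \<le> 1 / real (Suc m)" for m
  proof -
    have eq: "real_of_int (?g m \<omega>) = real (nat (?g m \<omega>))" using l by simp
    have "real (nat (?g m \<omega>)) / real (Suc m) \<le> 1"
    proof -
      have "nat (?g m \<omega>) \<le> Suc m" using l by (intro floor_grid(1)) auto
      then have "real (nat (?g m \<omega>)) \<le> real (Suc m)" by (simp only: of_nat_le_iff)
      then show ?thesis by (subst divide_le_eq_1_pos) (simp_all del: of_nat_Suc)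
    qed
    then show "real_of_int (?g m \<omega>) / real (Suc m) \<in> {0..1}"
      unfolding eq by (simp del: of_nat_Suc)
    show "\<bar>real_of_int (?g m \<omega>) / real (Suc m) - L n \<omega>\<bar> \<le> 1 / real (Suc m)"
      unfolding eq using l by (intro floor_grid(2)) auto
  qed
  have inv: "(\<lambda>n. 1 / real (Suc n)) \<longlonglongrightarrow> 0" using LIMSEQ_inverse_real_of_nat by (simp add: inverse_eq_divide)
  have "(\<lambda>m. real_of_int (?g m \<omega>) / real (Suc m) - L n \<omega>) \<longlonglongrightarrow> 0"
    by (rule Lim_null_comparison[OF _ inv], intro always_eventually allI) (unfold real_norm_def, rule d)
  from tendsto_add[OF this tendsto_const[of "L n \<omega>"]]
  have lim: "(\<lambda>m. real_of_int (?g m \<omega>) / real (Suc m)) \<longlonglongrightarrow> L n \<omega>" by simp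
  have "(\<lambda>m. E \<omega> (real_of_int (?g m \<omega>) / real (Suc m))) \<longlonglongrightarrow> E \<omega> (L n \<omega>)"
    using l by (intro continuous_on_tendsto_compose[OF continuous_path[OF \<omega>] lim] always_eventually allI g) auto
  then show "(\<lambda>m. ?E m (?g m \<omega>) \<omega>) \<longlonglongrightarrow> E \<omega> (L n \<omega>)"
    unfolding clipped_def using g by (simp only: if_True)
qed

lemma measurable_wings:
  assumes w [measurable]: "w \<in> measurable N K" and a: "a \<in> measurable N unif" and b: "b \<in> measurable N unif"
  shows "Measurable.pred N (\<lambda>z. a z \<in> left_wing (E (w z)) (L n (w z)) \<and> b z \<in> right_wing (E (w z)) (L n (w z)))"
proof -
  have ab [measurable]: "a \<in> borel_measurable N" "b \<in> borel_measurable N"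
    using a b by (auto simp: measurable_restrict_space2_iff measurable_lborel1)
  have L [measurable]: "(\<lambda>z. L n (w z)) \<in> borel_measurable N"
    using measurable_compose[OF w measurable_position] .
  have EL [measurable]: "(\<lambda>z. E (w z) (L n (w z))) \<in> borel_measurable N"
    using measurable_compose[OF w measurable_minimum] .
  let ?E = "\<lambda>(q::rat) z. clipped (of_rat q) (w z)"
  have Eq [measurable]: "?E q \<in> borel_measurable N" for q
    by (rule measurable_compose[OF w measurable_clipped])
  have "Measurable.pred N (\<lambda>z. a z < L n (w z) \<and> L n (w z) < b z \<and>
    (\<forall>m. \<exists>k. \<forall>q. a z \<le> of_rat q \<and> of_rat q \<le> b z \<and> 1 / real (Suc m) \<le> \<bar>of_rat q - L n (w z)\<bar> \<longrightarrow>
      E (w z) (L n (w z)) + 1 / real (Suc k) \<le> ?E q z))"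
    by measurable
  also have "?this \<longleftrightarrow> ?thesis"
  proof (rule measurable_cong)
    fix z assume z: "z \<in> space N"
    have wz: "w z \<in> space K" using measurable_space[OF w z] .
    have az: "0 \<le> a z" "b z \<le> 1" using measurable_space[OF a z] measurable_space[OF b z] by auto
    have "?E q z = E (w z) (of_rat q)" if "a z \<le> of_rat q" "of_rat q \<le> b z" for q
    proof -
      have "of_rat q \<in> {0..1::real}" using that az unfolding atLeastAtMost_iff by linarith
      then show ?thesis unfolding clipped_def by (simp only: if_True)
    qed
    then show "(a z < L n (w z) \<and> L n (w z) < b z \<and>
    (\<forall>m. \<exists>k. \<forall>q. a z \<le> of_rat q \<and> of_rat q \<le> b z \<and> 1 / real (Suc m) \<le> \<bar>of_rat q - L n (w z)\<bar> \<longrightarrow>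
      E (w z) (L n (w z)) + 1 / real (Suc k) \<le> ?E q z)) =
      (a z \<in> left_wing (E (w z)) (L n (w z)) \<and> b z \<in> right_wing (E (w z)) (L n (w z)))"
      unfolding wings_iff_rational[OF continuous_path[OF wz] az] by (simp cong: imp_cong del: of_nat_Suc)
  qed
  finally show ?thesis .
qed

lemma measurable_less:
  assumes w: "w \<in> measurable N K" and a: "a \<in> measurable N unif" and b: "b \<in> measurable N unif"
    and g: "\<And>n. Measurable.pred K (\<lambda>\<omega>. g \<omega> (L n \<omega>) = (1::int))"
  shows "Measurable.pred N (\<lambda>z. excursion_less (E (w z)) (g (w z)) (a z) (b z))"
proof -
  have ab [measurable]: "a \<in> borel_measurable N" "b \<in> borel_measurable N"
    using a b by (auto simp: measurable_restrict_space2_iff measurable_lborel1)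
  define P where "P n z \<longleftrightarrow> g (w z) (L n (w z)) = 1" for n z
  define A where "A n z \<longleftrightarrow> a z \<in> left_wing (E (w z)) (L n (w z)) \<and> b z \<in> right_wing (E (w z)) (L n (w z))" for n z
  define B where "B n z \<longleftrightarrow> b z \<in> left_wing (E (w z)) (L n (w z)) \<and> a z \<in> right_wing (E (w z)) (L n (w z))" for n z
  have [measurable]: "Measurable.pred N (P n)" "Measurable.pred N (A n)" "Measurable.pred N (B n)" for n
    unfolding P_def A_def B_def
    by (rule measurable_compose[OF w g] measurable_wings[OF w a b] measurable_wings[OF w b a])+
  have "Measurable.pred N (\<lambda>z. (a z < b z \<and> (\<exists>n. P n z \<and> A n z)) \<or> (b z < a z \<and> \<not> (\<exists>n. P n z \<and> B n z)))"
    by measurable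
  also have "?this \<longleftrightarrow> ?thesis"
  proof (rule measurable_cong)
    fix z assume z: "z \<in> space N"
    have wz: "w z \<in> space K" using measurable_space[OF w z] .
    have az: "0 \<le> a z" "a z \<le> 1" "0 \<le> b z" "b z \<le> 1"
      using measurable_space[OF a z] measurable_space[OF b z] by auto
    have "positive_at_minimum (E (w z)) (g (w z)) x y \<longleftrightarrow>
      (\<exists>n. g (w z) (L n (w z)) = 1 \<and> x \<in> left_wing (E (w z)) (L n (w z)) \<and> y \<in> right_wing (E (w z)) (L n (w z)))"
      if "0 \<le> x" "y \<le> 1" for x y
      unfolding positive_at_minimum_iff[OF that] range_position[OF wz, symmetric] by auto
    then show "((a z < b z \<and> (\<exists>n. P n z \<and> A n z)) \<or> (b z < a z \<and> \<not> (\<exists>n. P n z \<and> B n z))) =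
      excursion_less (E (w z)) (g (w z)) (a z) (b z)"
      using az by (simp add: excursion_less_def P_def A_def B_def)
  qed
  finally show ?thesis .
qed

lemma measurable_psi_joint:
  assumes g: "\<And>n. Measurable.pred K (\<lambda>\<omega>. g \<omega> (L n \<omega>) = (1::int))"
  shows "(\<lambda>(\<omega>, t). psi (E \<omega>) (g \<omega>) t) \<in> borel_measurable (K \<Otimes>\<^sub>M unif)"
proof -
  have "Measurable.pred ((K \<Otimes>\<^sub>M unif) \<Otimes>\<^sub>M unif) (\<lambda>z. excursion_less (E (fst (fst z))) (g (fst (fst z))) (snd z) (snd (fst z)))"
    using measurable_less[where g=g, OF measurable_compose[OF measurable_fst measurable_fst]
        measurable_snd measurable_compose[OF measurable_fst measurable_snd] g] .
  then have Q: "{z \<in> space ((K \<Otimes>\<^sub>M unif) \<Otimes>\<^sub>M unif). excursion_less (E (fst (fst z))) (g (fst (fst z))) (snd z) (snd (fst z))}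
      \<in> sets ((K \<Otimes>\<^sub>M unif) \<Otimes>\<^sub>M unif)" (is "?Q \<in> _")
    by (rule predE)
  have "(\<lambda>z. enn2real (emeasure unif (Pair z -` ?Q))) \<in> borel_measurable (K \<Otimes>\<^sub>M unif)"
    using unif.measurable_emeasure_Pair[OF Q] by measurable
  also have "?this \<longleftrightarrow> ?thesis"
  proof (rule measurable_cong)
    fix z assume z: "z \<in> space (K \<Otimes>\<^sub>M unif)"
    obtain \<omega> t where zt: "z = (\<omega>, t)" by (cases z)
    have \<omega>: "\<omega> \<in> space K" "t \<in> {0..1}" using z zt by (auto simp: space_pair_measure)
    have "Pair z -` ?Q = {x\<in>space unif. excursion_less (E \<omega>) (g \<omega>) x t}"
      using \<omega> zt by (auto simp: space_pair_measure)
    then show "enn2real (emeasure unif (Pair z -` ?Q)) = (\<lambda>(\<omega>, t). psi (E \<omega>) (g \<omega>) t) z"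
      using psi_eq_rank[OF countable_minima[OF \<omega>(1)] \<omega>(2)] zt by (simp add: measure_def)
  qed
  finally show ?thesis .
qed

lemma measurable_integral_psi:
  assumes g: "\<And>n. Measurable.pred K (\<lambda>\<omega>. g \<omega> (L n \<omega>) = (1::int))"
  shows "(\<lambda>\<omega>. \<integral>t. t * psi (E \<omega>) (g \<omega>) t \<partial>unif) \<in> borel_measurable K"
proof -
  have [measurable]: "(\<lambda>t. t) \<in> borel_measurable unif"
    by (intro measurable_restrict_space1) simp
  have "(\<lambda>(\<omega>, t). t * psi (E \<omega>) (g \<omega>) t) \<in> borel_measurable (K \<Otimes>\<^sub>M unif)"
    using borel_measurable_times[OF measurable_compose[OF measurable_snd \<open>(\<lambda>t. t) \<in> borel_measurable unif\<close>]
        measurable_psi_joint[where g=g, OF g]]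
    by (simp add: case_prod_beta)
  then show ?thesis by (rule unif.borel_measurable_lebesgue_integral)
qed

lemma measurable_permuton_on:
  assumes S: "finite S"
    and uniq: "\<And>\<omega>. \<omega> \<in> space K \<Longrightarrow> \<exists>N\<in>null_sets lborel. unique_minima_off (E \<omega>) N"
    and g: "\<And>k n. k \<in> S - {1} \<Longrightarrow> Measurable.pred K (\<lambda>\<omega>. g \<omega> (k - 1) (L n \<omega>) = (1::int))"
  shows "(\<lambda>\<omega>. permuton_on S (E \<omega>) (g \<omega>)) \<in> K \<rightarrow>\<^sub>M borel_of (weak_topology S)"
proof (rule measurable_weak_topologyI[OF S])
  fix \<omega> assume "\<omega> \<in> space K"
  then show "permuton_on S (E \<omega>) (g \<omega>) \<in> permutons S"
    using uniq permuton_on_in_permutons[OF countable_minima] by blast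
next
  fix n c
  let ?\<phi> = "\<lambda>k \<omega> t. if k = 1 then t else psi (E \<omega>) (g \<omega> (k - 1)) t"
  have [measurable]: "(\<lambda>t. t) \<in> borel_measurable unif"
    by (intro measurable_restrict_space1) simp
  have \<phi>: "(\<lambda>z. ?\<phi> k (fst z) (snd z)) \<in> borel_measurable (K \<Otimes>\<^sub>M unif)" if "k \<in> S" for k
  proof (cases "k = 1")
    case False
    then show ?thesis
      using measurable_psi_joint[of "\<lambda>\<omega>. g \<omega> (k - 1)"] g that by (simp add: case_prod_beta)
  qed (simp, measurable)
  have p: "Measurable.pred (K \<Otimes>\<^sub>M unif) (\<lambda>z. nat \<lfloor>real (Suc n) * ?\<phi> k (fst z) (snd z)\<rfloor> = c k)" if "k \<in> S" for k
    using \<phi>[OF that] by measurable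
  have "Measurable.pred (K \<Otimes>\<^sub>M unif) (\<lambda>z. \<forall>k\<in>S. nat \<lfloor>real (Suc n) * ?\<phi> k (fst z) (snd z)\<rfloor> = c k)"
    by (rule pred_intros_finite(3)[OF S p])
  then have Q: "{z \<in> space (K \<Otimes>\<^sub>M unif). \<forall>k\<in>S. nat \<lfloor>real (Suc n) * ?\<phi> k (fst z) (snd z)\<rfloor> = c k}
      \<in> sets (K \<Otimes>\<^sub>M unif)" (is "?Q \<in> _")
    by (rule predE)
  have "(\<lambda>\<omega>. enn2real (emeasure unif (Pair \<omega> -` ?Q))) \<in> borel_measurable K"
    using unif.measurable_emeasure_Pair[OF Q] by measurable
  also have "?this \<longleftrightarrow> (\<lambda>\<omega>. measure (permuton_on S (E \<omega>) (g \<omega>)) (cell n S c)) \<in> borel_measurable K"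
  proof (rule measurable_cong)
    fix \<omega> assume \<omega>: "\<omega> \<in> space K"
    let ?h = "\<lambda>t. \<lambda>k\<in>S. ?\<phi> k \<omega> t"
    note m = permuton_map_measurable[OF countable_minima[OF \<omega>], of "g \<omega>" S]
    have "measure (permuton_on S (E \<omega>) (g \<omega>)) (cell n S c) = measure unif (?h -` cell n S c \<inter> space unif)"
      unfolding permuton_on_def by (rule measure_distr[OF m cell_in_sets[OF S]])
    also have "?h -` cell n S c \<inter> space unif = Pair \<omega> -` ?Q"
    proof -
      have "?h t \<in> PiE S (\<lambda>_. {0..1})" if "t \<in> space unif" for t
        using measurable_space[OF m that] by (simp only: space_cube)
      then show ?thesis using \<omega> by (auto simp: cell_def space_pair_measure)
    qed
    finally show "enn2real (emeasure unif (Pair \<omega> -` ?Q)) = measure (permuton_on S (E \<omega>) (g \<omega>)) (cell n S c)"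
      by (simp add: measure_def)
  qed
  finally show "(\<lambda>\<omega>. measure (permuton_on S (E \<omega>) (g \<omega>)) (cell n S c)) \<in> borel_measurable K" .
qed

end

section \<open>Independence of a single sign from the rest\<close>

lemma prob_positive_sign:
  assumes "0 < q" "q < 1"
  shows "measure_pmf.prob (sign_pmf q) {1} = q"
proof -
  have "(\<lambda>b. if b then 1 else - 1 :: int) -` {1} = {True}" by (auto split: if_splits)
  then have "measure_pmf.prob (sign_pmf q) {1} = measure_pmf.prob (bernoulli_pmf q) {True}"
    unfolding sign_pmf_def measure_map_pmf by (rule arg_cong)
  also have "\<dots> = q" using assms by (simp add: measure_pmf_single)
  finally show ?thesis .
qed

context labelled_brownian_excursion
begin

definition path_space :: "((real \<Rightarrow> real) \<times> (nat \<Rightarrow> real)) measure" where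
  "path_space = (\<Pi>\<^sub>M t\<in>{0..1}. borel) \<Otimes>\<^sub>M (\<Pi>\<^sub>M n\<in>UNIV. borel)"

definition path :: "'a \<Rightarrow> (real \<Rightarrow> real) \<times> (nat \<Rightarrow> real)" where
  "path \<omega> = (\<lambda>t\<in>{0..1}. e \<omega> t, \<lambda>n. ell n \<omega>)"

definition sign :: "nat \<times> nat \<Rightarrow> 'a \<Rightarrow> int" where
  "sign k \<omega> = s \<omega> (fst k) (ell (snd k) \<omega>)"

lemma measurable_path: "path \<in> M \<rightarrow>\<^sub>M path_space"
  unfolding path_def[abs_def] path_space_def
  by (intro measurable_Pair measurable_restrict measurable_PiM_single' random_variable_excursion random_variable_ell)
     auto

lemma measurable_sign: "fst k \<in> {1..<d} \<Longrightarrow> sign k \<in> M \<rightarrow>\<^sub>M count_space UNIV"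
  unfolding sign_def[abs_def] by (rule random_variable_sign)

text \<open>The assumption on the joint law, read on cylinder sets. All independence statements below are
  derived from this identity.\<close>
lemma prob_path_signs_eq:
  assumes A: "A \<in> sets path_space" and J: "finite J" "J \<subseteq> {1..<d} \<times> UNIV"
  shows "prob {\<omega>\<in>space M. path \<omega> \<in> A \<and> (\<forall>k\<in>J. sign k \<omega> \<in> B k)} =
    prob {\<omega>\<in>space M. path \<omega> \<in> A} * (\<Prod>k\<in>J. measure_pmf.prob (sign_pmf (p (fst k))) (B k))"
proof -
  let ?N = "\<lambda>(i, n::nat). measure_pmf (sign_pmf (p i))"
  let ?I = "{1..<d} \<times> (UNIV :: nat set)"
  let ?Q = "PiM ?I ?N"
  let ?Y = "\<lambda>\<omega>. \<lambda>k\<in>?I. sign k \<omega>"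
  interpret Q: product_prob_space ?N ?I
    by (intro product_prob_spaceI) (auto simp: split_beta intro: prob_space_measure_pmf)
  have iid: "distr M (path_space \<Otimes>\<^sub>M ?Q) (\<lambda>\<omega>. (path \<omega>, ?Y \<omega>)) = distr M path_space path \<Otimes>\<^sub>M ?Q"
  proof -
    have "?Y \<omega> = (\<lambda>(i, n)\<in>?I. s \<omega> i (ell n \<omega>))" for \<omega>
      by (auto simp: sign_def restrict_def fun_eq_iff)
    then show ?thesis using iid_signs unfolding Let_def path_space_def path_def[abs_def] by simp
  qed
  have Y: "?Y \<in> M \<rightarrow>\<^sub>M ?Q"
  proof (rule measurable_restrict)
    fix k assume "k \<in> ?I"
    then show "sign k \<in> M \<rightarrow>\<^sub>M ?N k"
      using measurable_sign[of k] by (auto simp: split_beta)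
  qed
  define C where "C = prod_emb ?I ?N J (Pi\<^sub>E J B)"
  have C: "C \<in> sets ?Q"
    unfolding C_def using J by (intro sets_PiM_I) (auto simp: split_beta)
  have "{\<omega>\<in>space M. path \<omega> \<in> A \<and> (\<forall>k\<in>J. sign k \<omega> \<in> B k)} = (\<lambda>\<omega>. (path \<omega>, ?Y \<omega>)) -` (A \<times> C) \<inter> space M"
  proof -
    have "?Y \<omega> \<in> C \<longleftrightarrow> (\<forall>k\<in>J. sign k \<omega> \<in> B k)" for \<omega>
      using J by (auto simp: C_def prod_emb_def PiE_iff split_beta restrict_def subset_eq extensional_def)
    then show ?thesis by auto
  qed
  then have "emeasure M {\<omega>\<in>space M. path \<omega> \<in> A \<and> (\<forall>k\<in>J. sign k \<omega> \<in> B k)} =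
      emeasure (distr M (path_space \<Otimes>\<^sub>M ?Q) (\<lambda>\<omega>. (path \<omega>, ?Y \<omega>))) (A \<times> C)"
    using A C measurable_path Y by (subst emeasure_distr) auto
  also have "\<dots> = emeasure (distr M path_space path) A * emeasure ?Q C"
    unfolding iid using A C by (intro Q.P.emeasure_pair_measure_Times) auto
  also have "emeasure (distr M path_space path) A = emeasure M {\<omega>\<in>space M. path \<omega> \<in> A}"
    using A measurable_path by (subst emeasure_distr) (auto simp: vimage_def Int_def conj_commute)
  also have "emeasure ?Q C = (\<Prod>k\<in>J. emeasure (?N k) (B k))"
    unfolding C_def using J by (intro Q.emeasure_PiM_emb) (auto simp: split_beta)
  also have "\<dots> = ennreal (\<Prod>k\<in>J. measure_pmf.prob (sign_pmf (p (fst k))) (B k))"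
    by (subst prod_ennreal[symmetric]) (auto simp: split_beta measure_pmf.emeasure_eq_measure)
  finally show ?thesis
    by (simp add: emeasure_eq_measure ennreal_mult[symmetric] prod_nonneg)
qed

text \<open>Generators of the information without the sign \<open>k\<^sub>0\<close>. The factor \<open>C\<close> adds all events of probability
  0 or 1; then almost sure properties of the path can be assumed everywhere, by modifying the path on
  an event of the \<sigma>-algebra. In this form the generators are stable under intersections, so that
  independence passes to the generated \<sigma>-algebra.\<close>
definition others :: "nat \<times> nat \<Rightarrow> 'a set set" where
  "others k\<^sub>0 = {{\<omega>\<in>space M. path \<omega> \<in> A \<and> (\<forall>k\<in>J. sign k \<omega> \<in> B k)} \<inter> C | A B C J.
    A \<in> sets path_space \<and> finite J \<and> J \<subseteq> {1..<d} \<times> UNIV - {k\<^sub>0} \<and> C \<in> events \<and> (prob C = 0 \<or> prob C = 1)}"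

lemma othersI:
  "A \<in> sets path_space \<Longrightarrow> finite J \<Longrightarrow> J \<subseteq> {1..<d} \<times> UNIV - {k\<^sub>0} \<Longrightarrow> C \<in> events \<Longrightarrow>
    prob C = 0 \<or> prob C = 1 \<Longrightarrow> {\<omega>\<in>space M. path \<omega> \<in> A \<and> (\<forall>k\<in>J. sign k \<omega> \<in> B k)} \<inter> C \<in> others k\<^sub>0"
  unfolding others_def by blast

lemma events_path_signs:
  assumes "A \<in> sets path_space" "finite J" "J \<subseteq> {1..<d} \<times> UNIV"
  shows "{\<omega>\<in>space M. path \<omega> \<in> A \<and> (\<forall>k\<in>J. sign k \<omega> \<in> B k)} \<in> events"
proof -
  have "Measurable.pred M (\<lambda>\<omega>. sign k \<omega> \<in> B k)" if "k \<in> J" for k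
    using that assms(3) by (intro pred_sets2[OF _ measurable_sign]) auto
  then have "Measurable.pred M (\<lambda>\<omega>. \<forall>k\<in>J. sign k \<omega> \<in> B k)"
    by (rule pred_intros_finite(3)[OF assms(2)])
  then have "(path -` A \<inter> space M) \<inter> {\<omega>\<in>space M. \<forall>k\<in>J. sign k \<omega> \<in> B k} \<in> events"
    by (intro sets.Int measurable_sets[OF measurable_path assms(1)] predE)
  also have "(path -` A \<inter> space M) \<inter> {\<omega>\<in>space M. \<forall>k\<in>J. sign k \<omega> \<in> B k} =
      {\<omega>\<in>space M. path \<omega> \<in> A \<and> (\<forall>k\<in>J. sign k \<omega> \<in> B k)}" by auto
  finally show ?thesis .
qed

lemma others_events: "others k\<^sub>0 \<subseteq> events"
  unfolding others_def by (safe intro!: sets.Int events_path_signs) blast+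

lemma zero_one_Int:
  assumes "C \<in> events" "D \<in> events" "prob C = 0 \<or> prob C = 1"
  shows "prob (D \<inter> C) = prob D * prob C"
proof (cases "prob C = 0")
  case True
  then have "prob (D \<inter> C) \<le> 0"
    using finite_measure_mono[of "D \<inter> C" C] assms by simp
  then show ?thesis using True measure_nonneg[of M "D \<inter> C"] by simp
next
  case False
  then have C: "prob C = 1" using assms by simp
  then have "AE \<omega> in M. \<omega> \<in> C" using assms by (simp add: prob_eq_1)
  then have "prob (D \<inter> C) = prob D"
    using assms by (intro finite_measure_eq_AE) auto
  then show ?thesis using C by simp
qed

lemma Int_stable_others: "Int_stable (others k\<^sub>0)"
proof (rule Int_stableI)
  fix a b assume "a \<in> others k\<^sub>0" "b \<in> others k\<^sub>0"
  then obtain A B C J A' B' C' J'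
    where a: "a = {\<omega>\<in>space M. path \<omega> \<in> A \<and> (\<forall>k\<in>J. sign k \<omega> \<in> B k)} \<inter> C"
      "A \<in> sets path_space" "finite J" "J \<subseteq> {1..<d} \<times> UNIV - {k\<^sub>0}" "C \<in> events" "prob C = 0 \<or> prob C = 1"
    and b: "b = {\<omega>\<in>space M. path \<omega> \<in> A' \<and> (\<forall>k\<in>J'. sign k \<omega> \<in> B' k)} \<inter> C'"
      "A' \<in> sets path_space" "finite J'" "J' \<subseteq> {1..<d} \<times> UNIV - {k\<^sub>0}" "C' \<in> events" "prob C' = 0 \<or> prob C' = 1"
    unfolding others_def by auto
  let ?B = "\<lambda>k. (if k \<in> J then B k else UNIV) \<inter> (if k \<in> J' then B' k else UNIV)"
  have eq: "a \<inter> b = {\<omega>\<in>space M. path \<omega> \<in> A \<inter> A' \<and> (\<forall>k\<in>J \<union> J'. sign k \<omega> \<in> ?B k)} \<inter> (C \<inter> C')"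
    unfolding a(1) b(1) by auto
  show "a \<inter> b \<in> others k\<^sub>0"
    unfolding eq
  proof (rule othersI)
    show "prob (C \<inter> C') = 0 \<or> prob (C \<inter> C') = 1"
      using zero_one_Int[OF b(5) a(5) b(6)] a(6) b(6) by auto
  qed (use a b in auto)
qed

definition other_events :: "nat \<times> nat \<Rightarrow> 'a measure" where
  "other_events k\<^sub>0 = sigma (space M) (others k\<^sub>0)"

lemma space_other_events [simp]: "space (other_events k\<^sub>0) = space M"
  by (simp add: other_events_def space_measure_of_conv)

lemma sets_other_events: "sets (other_events k\<^sub>0) = sigma_sets (space M) (others k\<^sub>0)"
  unfolding other_events_def using others_events sets.sets_into_space by (intro sets_measure_of) blast

lemma other_events_subset: "A \<in> sets (other_events k\<^sub>0) \<Longrightarrow> A \<in> events"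
  unfolding sets_other_events using sets.sigma_sets_subset[OF others_events] by blast

lemma indep_sign_other_events:
  assumes k: "fst k\<^sub>0 \<in> {1..<d}" and D: "D \<in> sets (other_events k\<^sub>0)"
  shows "prob (D \<inter> {\<omega>\<in>space M. sign k\<^sub>0 \<omega> = 1}) = prob D * prob {\<omega>\<in>space M. sign k\<^sub>0 \<omega> = 1}"
proof -
  let ?E = "{\<omega>\<in>space M. sign k\<^sub>0 \<omega> = 1}"
  have top: "space path_space \<in> sets path_space" by simp
  have k0: "{k\<^sub>0} \<subseteq> {1..<d} \<times> UNIV" using k by (cases k\<^sub>0) auto
  have pin: "path \<omega> \<in> space path_space" if "\<omega> \<in> space M" for \<omega>
    using measurable_space[OF measurable_path that] .
  have Eeq: "?E = {\<omega>\<in>space M. path \<omega> \<in> space path_space \<and> (\<forall>k\<in>{k\<^sub>0}. sign k \<omega> \<in> {1})}"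
    using pin by auto
  have Sp: "{\<omega> \<in> space M. path \<omega> \<in> space path_space} = space M" using pin by auto
  have E: "?E \<in> events" unfolding Eeq by (rule events_path_signs[OF top _ k0]) simp
  have pE: "prob ?E = measure_pmf.prob (sign_pmf (p (fst k\<^sub>0))) {1}"
    unfolding Eeq using prob_path_signs_eq[OF top _ k0, of "\<lambda>_. {1}"] by (simp add: Sp prob_space)
  have "indep_set (others k\<^sub>0) {?E}"
  proof (rule indep_setI)
    fix a b assume "a \<in> others k\<^sub>0" "b \<in> {?E}"
    then obtain A B C J where b: "b = ?E"
      and a: "a = {\<omega>\<in>space M. path \<omega> \<in> A \<and> (\<forall>k\<in>J. sign k \<omega> \<in> B k)} \<inter> C"
      "A \<in> sets path_space" "finite J" "J \<subseteq> {1..<d} \<times> UNIV - {k\<^sub>0}" "C \<in> events" "prob C = 0 \<or> prob C = 1"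
      unfolding others_def by auto
    have J: "J \<subseteq> {1..<d} \<times> UNIV" "insert k\<^sub>0 J \<subseteq> {1..<d} \<times> UNIV" "k\<^sub>0 \<notin> J" using a(4) k0 by auto
    let ?D = "{\<omega>\<in>space M. path \<omega> \<in> A \<and> (\<forall>k\<in>J. sign k \<omega> \<in> B k)}"
    have fin: "finite (insert k\<^sub>0 J)" using a(3) by simp
    let ?B = "B(k\<^sub>0 := {1})"
    have "a \<inter> b = {\<omega>\<in>space M. path \<omega> \<in> A \<and> (\<forall>k\<in>insert k\<^sub>0 J. sign k \<omega> \<in> ?B k)} \<inter> C"
      unfolding a(1) b using J(3) by (auto split: if_splits)
    then have "prob (a \<inter> b) = prob {\<omega>\<in>space M. path \<omega> \<in> A \<and> (\<forall>k\<in>insert k\<^sub>0 J. sign k \<omega> \<in> ?B k)} * prob C"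
      using zero_one_Int[OF a(5) events_path_signs[OF a(2) fin J(2), of ?B] a(6)] by (simp only:)
    also have "prob {\<omega>\<in>space M. path \<omega> \<in> A \<and> (\<forall>k\<in>insert k\<^sub>0 J. sign k \<omega> \<in> ?B k)} =
        prob {\<omega>\<in>space M. path \<omega> \<in> A} * (\<Prod>k\<in>insert k\<^sub>0 J. measure_pmf.prob (sign_pmf (p (fst k))) (?B k))"
      using a(3) by (intro prob_path_signs_eq[OF a(2) _ J(2)]) simp
    also have "(\<Prod>k\<in>insert k\<^sub>0 J. measure_pmf.prob (sign_pmf (p (fst k))) (?B k)) =
        prob ?E * (\<Prod>k\<in>J. measure_pmf.prob (sign_pmf (p (fst k))) (?B k))"
      using a(3) J(3) by (simp add: pE)
    also have "(\<Prod>k\<in>J. measure_pmf.prob (sign_pmf (p (fst k))) (?B k)) =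
        (\<Prod>k\<in>J. measure_pmf.prob (sign_pmf (p (fst k))) (B k))"
      using J(3) by (intro prod.cong) auto
    also have "prob {\<omega>\<in>space M. path \<omega> \<in> A} * (prob ?E * (\<Prod>k\<in>J. measure_pmf.prob (sign_pmf (p (fst k))) (B k))) * prob C
        = prob ?D * prob C * prob ?E"
      using prob_path_signs_eq[OF a(2,3) J(1), of B] by simp
    also have "prob ?D * prob C = prob a"
      unfolding a(1) using zero_one_Int[OF a(5) events_path_signs[OF a(2,3) J(1)] a(6)] by simp
    finally show "prob (a \<inter> b) = prob a * prob b" unfolding b .
  qed (use others_events E in auto)
  then have "indep_set (sigma_sets (space M) (others k\<^sub>0)) (sigma_sets (space M) {?E})"
    by (rule indep_set_sigma_sets[OF _ Int_stable_others]) (auto intro: Int_stableI)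
  then show ?thesis
    using D unfolding sets_other_events by (intro indep_setD) auto
qed

lemma prob_sign:
  assumes k: "fst k\<^sub>0 \<in> {1..<d}" and p: "0 < p (fst k\<^sub>0)" "p (fst k\<^sub>0) < 1"
  shows "prob {\<omega>\<in>space M. sign k\<^sub>0 \<omega> = 1} = p (fst k\<^sub>0)"
proof -
  have k0: "{k\<^sub>0} \<subseteq> {1..<d} \<times> UNIV" using k by (cases k\<^sub>0) auto
  have pin: "path \<omega> \<in> space path_space" if "\<omega> \<in> space M" for \<omega>
    using measurable_space[OF measurable_path that] .
  have Eeq: "{\<omega>\<in>space M. sign k\<^sub>0 \<omega> = 1} = {\<omega>\<in>space M. path \<omega> \<in> space path_space \<and> (\<forall>k\<in>{k\<^sub>0}. sign k \<omega> \<in> {1})}"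
    using pin by auto
  have Sp: "{\<omega> \<in> space M. path \<omega> \<in> space path_space} = space M" using pin by auto
  show ?thesis
    unfolding Eeq using prob_path_signs_eq[OF sets.top _ k0, of "\<lambda>_. {1}"]
    by (simp add: Sp prob_space prob_positive_sign[OF p])
qed

lemma path_measurable_other_events:
  assumes f: "f \<in> path_space \<rightarrow>\<^sub>M N"
  shows "(\<lambda>\<omega>. f (path \<omega>)) \<in> other_events k\<^sub>0 \<rightarrow>\<^sub>M N"
proof (rule measurable_compose[OF _ f], rule measurableI)
  fix A assume A: "A \<in> sets path_space"
  have "{\<omega>\<in>space M. path \<omega> \<in> A \<and> (\<forall>k\<in>{}. sign k \<omega> \<in> UNIV)} \<inter> space M \<in> others k\<^sub>0"
    using A by (intro othersI) (auto simp: prob_space)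
  also have "{\<omega>\<in>space M. path \<omega> \<in> A \<and> (\<forall>k\<in>{}. sign k \<omega> \<in> UNIV)} \<inter> space M = path -` A \<inter> space M" by auto
  finally show "path -` A \<inter> space (other_events k\<^sub>0) \<in> sets (other_events k\<^sub>0)"
    unfolding sets_other_events by auto
qed (use measurable_space[OF measurable_path] in simp)

lemma sign_measurable_other_events:
  assumes k: "fst k \<in> {1..<d}" "k \<noteq> k\<^sub>0"
  shows "Measurable.pred (other_events k\<^sub>0) (\<lambda>\<omega>. sign k \<omega> = 1)"
proof -
  have pin: "path \<omega> \<in> space path_space" if "\<omega> \<in> space M" for \<omega>
    using measurable_space[OF measurable_path that] .
  have "{\<omega>\<in>space M. path \<omega> \<in> space path_space \<and> (\<forall>k\<in>{k}. sign k \<omega> \<in> {1})} \<inter> space M \<in> others k\<^sub>0"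
    using k by (intro othersI) (auto simp: prob_space mem_Times_iff)
  also have "{\<omega>\<in>space M. path \<omega> \<in> space path_space \<and> (\<forall>k\<in>{k}. sign k \<omega> \<in> {1})} \<inter> space M
      = {\<omega> \<in> space (other_events k\<^sub>0). sign k \<omega> = 1}"
    using pin by auto
  finally show ?thesis
    unfolding pred_def sets_other_events by auto
qed

lemma zero_one_other_events:
  assumes "C \<in> events" "prob C = 0 \<or> prob C = 1"
  shows "C \<in> sets (other_events k\<^sub>0)"
proof -
  have "path \<omega> \<in> space path_space" if "\<omega> \<in> space M" for \<omega>
    using measurable_space[OF measurable_path that] .
  then have "C = {\<omega>\<in>space M. path \<omega> \<in> space path_space \<and> (\<forall>k\<in>{}. sign k \<omega> \<in> UNIV)} \<inter> C"
    using sets.sets_into_space[OF assms(1)] by auto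
  also have "\<dots> \<in> others k\<^sub>0"
    using assms by (intro othersI) auto
  finally show ?thesis unfolding sets_other_events by auto
qed

lemma AE_regular_path:
  "AE \<omega> in M. continuous_on {0..1} (e \<omega>) \<and> bij_betw (\<lambda>n. ell n \<omega>) UNIV (local_minima (e \<omega>)) \<and>
     (\<exists>N\<in>null_sets lborel. unique_minima_off (e \<omega>) N)"
  using continuous_excursion enumeration unique_minima
  by eventually_elim (simp add: unique_minima_off_def)

end

section \<open>A missing coordinate is not determined\<close>

theorem proposition5p10:
  fixes M :: "'a measure" and d :: nat and p :: "nat \<Rightarrow> real"
    and e :: "'a \<Rightarrow> real \<Rightarrow> real" and ell :: "nat \<Rightarrow> 'a \<Rightarrow> real"
    and s :: "'a \<Rightarrow> nat \<Rightarrow> real \<Rightarrow> int" and S :: "nat set"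
  assumes "d \<ge> 2"
    and "\<And>i. i \<in> {1..<d} \<Longrightarrow> 0 < p i \<and> p i < 1"
    and "labelled_brownian_excursion M e d p ell s"
    and "S \<subset> {1..d}" and "1 \<in> S"
  shows "\<not> (\<exists>F \<in> borel_of (weak_topology S) \<rightarrow>\<^sub>M borel_of (weak_topology {1..d}).
    AE \<omega> in M. separable_permuton d (e \<omega>) (s \<omega>)
      = F (marginal S (separable_permuton d (e \<omega>) (s \<omega>))))"
proof
  interpret labelled_brownian_excursion M e d p ell s by (fact assms(3))
  assume "\<exists>F \<in> borel_of (weak_topology S) \<rightarrow>\<^sub>M borel_of (weak_topology {1..d}).
    AE \<omega> in M. separable_permuton d (e \<omega>) (s \<omega>)
      = F (marginal S (separable_permuton d (e \<omega>) (s \<omega>)))"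
  then obtain F where F: "F \<in> borel_of (weak_topology S) \<rightarrow>\<^sub>M borel_of (weak_topology {1..d})"
    and AE_F: "AE \<omega> in M. separable_permuton d (e \<omega>) (s \<omega>)
      = F (marginal S (separable_permuton d (e \<omega>) (s \<omega>)))" by blast
  obtain \<kappa> where \<kappa>: "\<kappa> \<in> {1..d}" "\<kappa> \<notin> S" using assms(4) by blast
  define j where "j = \<kappa> - 1"
  have \<kappa>1: "\<kappa> \<noteq> 1" using \<kappa>(2) assms(5) by auto
  then have j: "j \<in> {1..<d}" using \<kappa>(1) by (auto simp: j_def)
  let ?K = "other_events (j, 0)"
  have "AE \<omega> in M. (continuous_on {0..1} (e \<omega>) \<and> bij_betw (\<lambda>n. ell n \<omega>) UNIV (local_minima (e \<omega>)) \<and>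
     (\<exists>N\<in>null_sets lborel. unique_minima_off (e \<omega>) N)) \<and>
     separable_permuton d (e \<omega>) (s \<omega>) = F (marginal S (separable_permuton d (e \<omega>) (s \<omega>)))"
    using AE_regular_path AE_F by eventually_elim simp
  then obtain \<Omega>\<^sub>0 where \<Omega>0: "\<Omega>\<^sub>0 \<in> events" "prob \<Omega>\<^sub>0 = 1"
    and good: "\<And>\<omega>. \<omega> \<in> \<Omega>\<^sub>0 \<Longrightarrow> continuous_on {0..1} (e \<omega>) \<and> bij_betw (\<lambda>n. ell n \<omega>) UNIV (local_minima (e \<omega>)) \<and>
     (\<exists>N\<in>null_sets lborel. unique_minima_off (e \<omega>) N)"
    and \<Omega>0_F: "\<And>\<omega>. \<omega> \<in> \<Omega>\<^sub>0 \<Longrightarrow> separable_permuton d (e \<omega>) (s \<omega>) = F (marginal S (separable_permuton d (e \<omega>) (s \<omega>)))"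
    by (rule AE_E_prob) (auto simp: subset_eq)
  have \<Omega>0_sub: "\<Omega>\<^sub>0 \<subseteq> space M" using \<Omega>0(1) by (rule sets.sets_into_space)
  obtain \<omega>\<^sub>0 where \<omega>0: "\<omega>\<^sub>0 \<in> \<Omega>\<^sub>0" using \<Omega>0(2) by fastforce
  \<comment> \<open>Composing with \<open>\<rho>\<close> replaces the exceptional outcomes by a fixed regular one, so that all almost
    sure properties hold everywhere.\<close>
  define \<rho> where "\<rho> \<omega> = (if \<omega> \<in> \<Omega>\<^sub>0 then \<omega> else \<omega>\<^sub>0)" for \<omega>
  have \<rho>: "\<rho> \<omega> \<in> \<Omega>\<^sub>0" for \<omega> using \<omega>0 by (simp add: \<rho>_def)
  have \<Omega>0_K: "\<Omega>\<^sub>0 \<in> sets ?K" using zero_one_other_events \<Omega>0 by blast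
  have modify: "(\<lambda>\<omega>. f (\<rho> \<omega>)) \<in> ?K \<rightarrow>\<^sub>M N" if "f \<in> ?K \<rightarrow>\<^sub>M N" for f and N :: "'n measure"
  proof -
    have "f \<omega>\<^sub>0 \<in> space N" using measurable_space[OF that, of \<omega>\<^sub>0] \<omega>0 \<Omega>0_sub by auto
    then have "(\<lambda>\<omega>. if \<omega> \<in> \<Omega>\<^sub>0 then f \<omega> else f \<omega>\<^sub>0) \<in> ?K \<rightarrow>\<^sub>M N"
      using that \<Omega>0_K \<Omega>0_sub by (intro measurable_If_set) (auto simp: Int_absorb2)
    also have "(\<lambda>\<omega>. if \<omega> \<in> \<Omega>\<^sub>0 then f \<omega> else f \<omega>\<^sub>0) = (\<lambda>\<omega>. f (\<rho> \<omega>))"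
      by (auto simp: \<rho>_def)
    finally show ?thesis .
  qed
  interpret lm: measurable_labelled_minima ?K "\<lambda>\<omega>. e (\<rho> \<omega>)" "\<lambda>n \<omega>. ell n (\<rho> \<omega>)"
  proof
    show "continuous_on {0..1} (e (\<rho> \<omega>))" for \<omega> using good[OF \<rho>] by blast
    show "range (\<lambda>n. ell n (\<rho> \<omega>)) = local_minima (e (\<rho> \<omega>))" for \<omega>
      using good[OF \<rho>] by (auto simp: bij_betw_def)
    show "(\<lambda>\<omega>. e (\<rho> \<omega>) t) \<in> borel_measurable ?K" if t: "t \<in> {0..1}" for t
    proof (rule modify)
      have "(\<lambda>x. fst x t) \<in> borel_measurable path_space"
        unfolding path_space_def using t
        by (intro measurable_compose[OF measurable_fst measurable_component_singleton])
      from path_measurable_other_events[OF this, of "(j, 0)"] show "(\<lambda>\<omega>. e \<omega> t) \<in> borel_measurable ?K"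
        using t by (simp add: path_def)
    qed
    show "(\<lambda>\<omega>. ell n (\<rho> \<omega>)) \<in> borel_measurable ?K" for n
    proof (rule modify)
      have "(\<lambda>x. snd x n) \<in> borel_measurable path_space"
        unfolding path_space_def
        by (intro measurable_compose[OF measurable_snd measurable_component_singleton]) simp
      from path_measurable_other_events[OF this, of "(j, 0)"] show "ell n \<in> borel_measurable ?K"
        by (simp add: path_def)
    qed
  qed
  have signs: "Measurable.pred ?K (\<lambda>\<omega>. s (\<rho> \<omega>) i (ell n (\<rho> \<omega>)) = 1)"
    if "i \<in> {1..<d}" "(i, n) \<noteq> (j, 0)" for i n
    using modify[OF sign_measurable_other_events[of "(i, n)" "(j, 0)"]] that by (simp add: sign_def)
  have S: "finite S" "S \<subseteq> {1..d}" using assms(4) finite_subset by auto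
  have L: "countable (local_minima (e \<omega>))" if "\<omega> \<in> \<Omega>\<^sub>0" for \<omega>
    using good[OF that] by (metis bij_betw_imp_surj_on countableI_type countable_image)

  let ?h = "\<lambda>\<omega>. permuton_on S (e (\<rho> \<omega>)) (s (\<rho> \<omega>))"
  have h: "?h \<in> ?K \<rightarrow>\<^sub>M borel_of (weak_topology S)"
  proof (rule lm.measurable_permuton_on[OF S(1)])
    show "\<exists>N\<in>null_sets lborel. unique_minima_off (e (\<rho> \<omega>)) N" for \<omega> using good[OF \<rho>] by blast
    show "Measurable.pred ?K (\<lambda>\<omega>. s (\<rho> \<omega>) (k - 1) (ell n (\<rho> \<omega>)) = 1)" if k: "k \<in> S - {1}" for k n
    proof (rule signs)
      have "k \<in> {1..d}" "k \<noteq> \<kappa>" "k \<noteq> 1" using k S \<kappa> by auto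
      then show "k - 1 \<in> {1..<d}" "(k - 1, n) \<noteq> (j, 0)"
        using \<kappa>(1) \<kappa>1 by (auto simp: j_def)
    qed
  qed
  \<comment> \<open>\<open>G\<close> sees the full permuton, yet is measurable without the sign \<open>(j, 0)\<close>, as it is
    computed from the marginal.\<close>
  define G where "G \<omega> = (\<integral>x. x 1 * x \<kappa> \<partial>F (?h \<omega>))" for \<omega>
  have G: "G \<in> borel_measurable ?K"
  proof -
    have co: "continuous_map (cube_topology {1..d}) euclideanreal (\<lambda>x. x i)" if "i \<in> {1..d}" for i
      using continuous_map_product_projection[OF that, of "\<lambda>_. top_of_set {0..1::real}"]
      unfolding cube_topology_def continuous_map_in_subtopology by blast
    have "continuous_map (cube_topology {1..d}) euclideanreal (\<lambda>x. x 1 * x \<kappa>)"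
      using \<kappa>(1) assms(1) by (intro continuous_map_real_mult co) auto
    from measurable_compose[OF measurable_compose[OF h F] measurable_weak_integral[OF this]]
    show ?thesis by (simp add: G_def[abs_def])
  qed
  have G_eq: "G \<omega> = (\<integral>t. t * psi (e \<omega>) (s \<omega> j) t \<partial>unif)" if \<omega>: "\<omega> \<in> \<Omega>\<^sub>0" for \<omega>
  proof -
    have "F (?h \<omega>) = F (marginal S (separable_permuton d (e \<omega>) (s \<omega>)))"
      using \<omega> unfolding separable_permuton_eq[OF L[OF \<omega>]] marginal_permuton_on[OF L[OF \<omega>] S(2)] by (simp add: \<rho>_def)
    also have "\<dots> = permuton_on {1..d} (e \<omega>) (s \<omega>)"
      using \<Omega>0_F[OF \<omega>] separable_permuton_eq[OF L[OF \<omega>]] by simp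
    finally show ?thesis
      unfolding G_def j_def using integral_permuton_on[OF L[OF \<omega>] _ \<kappa>(1) \<kappa>1, of "s \<omega>"] assms(1) by simp
  qed

  \<comment> \<open>\<open>R\<close> is the reference value: what \<open>G\<close> would be if the sign in question were \<open>- 1\<close>.\<close>
  define g where "g \<omega> = (s \<omega> j)(ell 0 \<omega> := - 1)" for \<omega>
  define R where "R \<omega> = (\<integral>t. t * psi (e (\<rho> \<omega>)) (g (\<rho> \<omega>)) t \<partial>unif)" for \<omega>
  have R: "R \<in> borel_measurable ?K"
    unfolding R_def[abs_def]
  proof (rule lm.measurable_integral_psi[where g="\<lambda>\<omega>. g (\<rho> \<omega>)"])
    fix n
    show "Measurable.pred ?K (\<lambda>\<omega>. g (\<rho> \<omega>) (ell n (\<rho> \<omega>)) = 1)"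
    proof (cases "n = 0")
      case True
      then show ?thesis by (simp add: g_def)
    next
      case False
      have "ell n (\<rho> \<omega>) \<noteq> ell 0 (\<rho> \<omega>)" for \<omega>
        using good[OF \<rho>, of \<omega>] False by (auto simp: bij_betw_def dest: injD)
      then show ?thesis using signs[OF j, of n] False by (simp add: g_def)
    qed
  qed
  let ?E = "{\<omega>\<in>space M. sign (j, 0) \<omega> = 1}" and ?D = "{\<omega>\<in>space M. R \<omega> < G \<omega>}"
  have D: "?D \<in> sets ?K"
    using borel_measurable_less[OF R G] by simp
  have ED: "\<omega> \<in> ?E \<longleftrightarrow> \<omega> \<in> ?D" if \<omega>: "\<omega> \<in> \<Omega>\<^sub>0" for \<omega>
  proof -
    obtain N where N: "N \<in> null_sets lborel" "unique_minima_off (e \<omega>) N" using good[OF \<omega>] by blast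
    have min: "ell 0 \<omega> \<in> local_minima (e \<omega>)" using good[OF \<omega>] by (auto simp: bij_betw_def)
    have Rw: "R \<omega> = (\<integral>t. t * psi (e \<omega>) (g \<omega>) t \<partial>unif)" using \<omega> by (simp add: R_def \<rho>_def)
    show ?thesis
    proof (cases "s \<omega> j (ell 0 \<omega>) = 1")
      case True
      then have "R \<omega> < G \<omega>"
        unfolding Rw G_eq[OF \<omega>] g_def by (rule integral_flip[OF L[OF \<omega>] N min])
      then show ?thesis using True \<omega> \<Omega>0_sub by (auto simp: sign_def)
    next
      case False
      then have "psi (e \<omega>) (g \<omega>) = psi (e \<omega>) (s \<omega> j)"
        by (intro psi_cong_signs) (auto simp: g_def)
      then have "R \<omega> = G \<omega>" unfolding Rw G_eq[OF \<omega>] by simp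
      then show ?thesis using False by (simp add: sign_def)
    qed
  qed
  have E_events: "?E \<in> events"
    using measurable_sign[of "(j, 0)"] j by (auto intro!: predE pred_eq_const1)
  have D_events: "?D \<in> events" using D by (rule other_events_subset)
  have AE0: "AE \<omega> in M. \<omega> \<in> \<Omega>\<^sub>0" using \<Omega>0 by (simp add: prob_eq_1)
  have "prob ?D = prob ?E"
  proof (rule finite_measure_eq_AE)
    show "AE \<omega> in M. (\<omega> \<in> ?D) = (\<omega> \<in> ?E)" using AE0 by eventually_elim (rule ED[symmetric])
  qed (rule D_events E_events)+
  moreover have "prob (?D \<inter> ?E) = prob ?E"
  proof (rule finite_measure_eq_AE)
    show "AE \<omega> in M. (\<omega> \<in> ?D \<inter> ?E) = (\<omega> \<in> ?E)" using AE0 by eventually_elim (use ED in blast)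
  qed (rule sets.Int D_events E_events)+
  moreover have "prob (?D \<inter> ?E) = prob ?D * prob ?E"
    using j by (intro indep_sign_other_events[OF _ D]) simp
  moreover have "prob ?E = p j"
    using prob_sign[of "(j, 0)"] j assms(2)[OF j] by simp
  ultimately have "p j = p j * p j" by simp
  then show False using assms(2)[OF j] by simp
qed

end
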